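(* Let $S$ be a combinatorial inverse semigroup with $0$ that has finite intervals and admits a coherent set $\mathcal{C}$ of idempotent representatives of its $\mathcal{D}$-classes. Then $S$ is Morita equivalent to the labelled graph inverse semigroup $S_{\mathcal{C}}$, i.e. the inverse semigroup of the labelled graph space $(\mathcal{E},\mathcal{L},\mathcal{B})$ associated with $\mathcal{C}$.
   Context: Basics. For an inverse semigroup $S$, $E(S)$ is its set of idempotents, $s^*$ the inverse of $s$, $\leq$ the natural partial order, and $[s]$ the $\mathcal{D}$-class of $s$. $S$ is combinatorial if Green's relation $\mathcal{H}$ is trivial (so an element $s$ is determined by $s^*s$ and $ss^*$). The class $[0]=\{0\}\in S/\mathcal{D}$ is written $0$. For idempotents, $e\ll f$ means $e<f$ and there is no idempotent $g$ with $e<g<f$. $S$ has finite intervals if whenever $0\neq e\leq f$ in $E(S)$ there are idempotents $e=h_1\ll h_2\ll\cdots\ll h_n=f$. Morita equivalence. The idempotent splitting $C(S)$ is the category with objects $E(S)$, morphisms $(e,s,f)$ with $e,f\in E(S)$, $s\in eSf$, and composition $(e,s,f)(f,t,g)=(e,st,g)$. $S$ and $T$ are Morita equivalent if the categories $C(S)$ and $C(T)$ are equivalent. Coherent set. A complete set of idempotent representatives is a set $\mathcal{C}=\{e_v: v\in S/\mathcal{D}\}$ of idempotents containing exactly one element $e_v$ of each $\mathcal{D}$-class $v$ (so $e_0=0$). It is coherent for $S$ if (1) $e_ue_v\in\mathcal{C}$ for all $u,v\in S/\mathcal{D}$; (2) for all idempotents $f$, $0\neq e_u\leq f\leq e_v$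 implies $f\in\mathcal{C}$; (3) if $f,g\ll e_v$ with $f,g$ incomparable idempotents, then $fg\in\mathcal{C}$. Write $u\preceq v$ iff $e_u\leq e_v$; this makes $S/\mathcal{D}$ a meet semilattice. Labelled graphs. In a directed graph $\mathcal{E}=(\mathcal{E}^0,\mathcal{E}^1,r,s)$, a path of length $n\ge1$ is $\lambda=\lambda_1\cdots\lambda_n$ with $\lambda_i\in\mathcal{E}^1$ and $s(\lambda_i)=r(\lambda_{i+1})$; $r(\lambda)=r(\lambda_1)$, $s(\lambda)=s(\lambda_n)$. A labelled graph $(\mathcal{E},\mathcal{L})$ over an alphabet $\mathcal{A}$ has a labelling map $\mathcal{L}:\mathcal{E}^1\to\mathcal{A}$, extended by $\mathcal{L}(\lambda_1\cdots\lambda_n)=\mathcal{L}(\lambda_1)\cdots\mathcal{L}(\lambda_n)$. $\mathcal{L}^n$ is the set of labels of paths of length $n$, $\mathcal{L}^{\geq1}=\bigcup_{n\ge1}\mathcal{L}^n$, and $\mathcal{L}^*=\{\omega\}\cup\mathcal{L}^{\geq1}$ with $\omega$ the empty word. For $A\subseteq\mathcal{E}^0$ and $\alpha\in\mathcal{L}^{\ge1}$, $s(A,\alpha)=\{s(\lambda):\mathcal{L}(\lambda)=\alpha,\ r(\lambda)\in A\}$; $s(A,\omega)=A$; $s(\alpha)=s(\mathcal{E}^0,\alpha)$. A labelled graph space $(\mathcal{E},\mathcal{L},\mathcal{B})$ is a labelled graph with a collection $\mathcal{B}$ of subsets of $\mathcal{E}^0$ that is closed under finite intersections, closed under $A\mapsto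 s(A,\alpha)$ for $\alpha\in\mathcal{L}^*$, and contains $s(\alpha)$ for all $\alpha\in\mathcal{L}^{\ge1}$; it is weakly right resolving if $s(A\cap B,\alpha)=s(A,\alpha)\cap s(B,\alpha)$ for all $A,B\in\mathcal{B}$, $\alpha\in\mathcal{L}^{\ge1}$. The inverse semigroup of a weakly right resolving labelled graph space consists of $0$ and all triples $(\alpha,A,\beta)$ with $\alpha,\beta\in\mathcal{L}^*$, $\emptyset\ne A\in\mathcal{B}$, $A\subseteq s(\alpha)\cap s(\beta)$, with product $(\alpha,A,\beta)(\gamma,B,\delta)=(\alpha\gamma',s(A,\gamma')\cap B,\delta)$ if $\gamma=\beta\gamma'$, $=(\alpha,A\cap s(B,\beta'),\delta\beta')$ if $\beta=\gamma\beta'$, and $=0$ otherwise; a triple with empty middle entry is read as $0$. The labelled graph space associated with $\mathcal{C}$. $\mathcal{E}^0=(S/\mathcal{D})\setminus\{0\}$; $B_v=\{w\in\mathcal{E}^0:w\preceq v\}$; $\mathcal{B}=\{B_v:v\in\mathcal{E}^0\}\cup\{\emptyset\}$. For each $v\in\mathcal{E}^0$, each nonzero idempotent $f\ll e_v$ with $f\neq e_{[f]}$, and each $u\in B_{[f]}$, there is one edge $x_{v,f,u}$ with $r(x_{v,f,u})=v$, $s(x_{v,f,u})=u$ and label $\mathcal{L}(x_{v,f,u})=(v,f)$. These are all the edges. This is a weakly right resolving labelled graph space, and $S_{\mathcal{C}}$ denotes its inverse semigroup. *)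

theory Defs
  imports
    "HOL-Algebra.Congruence"
    "HOL-Library.Sublist"
    "Graph_Theory.Digraph"
begin

section \<open>Inverse semigroups with zero\<close>

record 'a semigroup0 = "'a partial_object" +
  smult :: "'a \<Rightarrow> 'a \<Rightarrow> 'a" (infixl \<open>\<cdot>\<index>\<close> 70)
  szero :: 'a (\<open>\<zero>\<^sub>s\<index>\<close>)

locale inverse_semigroup =
  fixes S :: "('a, 'b) semigroup0_scheme" (structure)
  assumes mult_closed: "\<lbrakk>x \<in> carrier S; y \<in> carrier S\<rbrakk> \<Longrightarrow> x \<cdot> y \<in> carrier S"
    and mult_assoc: "\<lbrakk>x \<in> carrier S; y \<in> carrier S; z \<in> carrier S\<rbrakk> \<Longrightarrow> (x \<cdot> y) \<cdot> z = x \<cdot> (y \<cdot> z)"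
    and unique_inverse: "x \<in> carrier S \<Longrightarrow> \<exists>!y. y \<in> carrier S \<and> x \<cdot> y \<cdot> x = x \<and> y \<cdot> x \<cdot> y = y"

locale inverse_semigroup0 = inverse_semigroup +
  assumes zero_closed: "\<zero>\<^sub>s \<in> carrier S"
    and zero_left: "x \<in> carrier S \<Longrightarrow> \<zero>\<^sub>s \<cdot> x = \<zero>\<^sub>s"
    and zero_right: "x \<in> carrier S \<Longrightarrow> x \<cdot> \<zero>\<^sub>s = \<zero>\<^sub>s"

definition idempotents :: "('a, 'b) semigroup0_scheme \<Rightarrow> 'a set" where
  "idempotents S = {e \<in> carrier S. e \<cdot>\<^bsub>S\<^esub> e = e}"

definition nat_le :: "('a, 'b) semigroup0_scheme \<Rightarrow> 'a \<Rightarrow> 'a \<Rightarrow> bool" where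
  "nat_le S s t \<longleftrightarrow> s \<in> carrier S \<and> t \<in> carrier S \<and> (\<exists>e \<in> idempotents S. s = e \<cdot>\<^bsub>S\<^esub> t)"

definition nat_less :: "('a, 'b) semigroup0_scheme \<Rightarrow> 'a \<Rightarrow> 'a \<Rightarrow> bool" where
  "nat_less S s t \<longleftrightarrow> nat_le S s t \<and> s \<noteq> t"

text \<open>The relation \<open>e \<lless> f\<close>, for idempotents only.\<close>

definition covered_by :: "('a, 'b) semigroup0_scheme \<Rightarrow> 'a \<Rightarrow> 'a \<Rightarrow> bool" where
  "covered_by S e f \<longleftrightarrow> e \<in> idempotents S \<and> f \<in> idempotents S \<and> nat_less S e f \<and>
     \<not> (\<exists>g \<in> idempotents S. nat_less S e g \<and> nat_less S g f)"

definition finite_intervals :: "('a, 'b) semigroup0_scheme \<Rightarrow> bool" where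
  "finite_intervals S \<longleftrightarrow>
     (\<forall>e \<in> idempotents S. \<forall>f \<in> idempotents S. e \<noteq> \<zero>\<^sub>s\<^bsub>S\<^esub> \<and> nat_le S e f \<longrightarrow>
        (\<exists>hs. hs \<noteq> [] \<and> set hs \<subseteq> idempotents S \<and> hd hs = e \<and> last hs = f \<and>
              successively (covered_by S) hs))"

subsection \<open>Green's relations\<close>

definition greenL :: "('a, 'b) semigroup0_scheme \<Rightarrow> 'a rel" where
  "greenL S = {(s, t). s \<in> carrier S \<and> t \<in> carrier S \<and>
     insert s {x \<cdot>\<^bsub>S\<^esub> s | x. x \<in> carrier S} = insert t {x \<cdot>\<^bsub>S\<^esub> t | x. x \<in> carrier S}}"

definition greenR :: "('a, 'b) semigroup0_scheme \<Rightarrow> 'a rel" where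
  "greenR S = {(s, t). s \<in> carrier S \<and> t \<in> carrier S \<and>
     insert s {s \<cdot>\<^bsub>S\<^esub> x | x. x \<in> carrier S} = insert t {t \<cdot>\<^bsub>S\<^esub> x | x. x \<in> carrier S}}"

definition greenH :: "('a, 'b) semigroup0_scheme \<Rightarrow> 'a rel" where
  "greenH S = greenL S \<inter> greenR S"

definition greenD :: "('a, 'b) semigroup0_scheme \<Rightarrow> 'a rel" where
  "greenD S = greenL S O greenR S"

definition Dclass :: "('a, 'b) semigroup0_scheme \<Rightarrow> 'a \<Rightarrow> 'a set" where
  "Dclass S s = greenD S `` {s}"

definition Dclasses :: "('a, 'b) semigroup0_scheme \<Rightarrow> 'a set set" where
  "Dclasses S = carrier S // greenD S"

definition combinatorial :: "('a, 'b) semigroup0_scheme \<Rightarrow> bool" where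
  "combinatorial S \<longleftrightarrow> (\<forall>(s, t) \<in> greenH S. s = t)"

section \<open>Categories, equivalence and Morita equivalence\<close>

record ('o, 'm) cat =
  Obj :: "'o set"
  Arr :: "'m set"
  Dom :: "'m \<Rightarrow> 'o"
  Cod :: "'m \<Rightarrow> 'o"
  Ident :: "'o \<Rightarrow> 'm"
  Comp :: "'m \<Rightarrow> 'm \<Rightarrow> 'm"

text \<open>\<open>Comp C g f\<close> is \<open>g\<close> after \<open>f\<close>; it is meaningful only if \<open>Dom C g = Cod C f\<close>.\<close>

locale cat =
  fixes C :: "('o, 'm) cat"
  assumes dom_obj: "f \<in> Arr C \<Longrightarrow> Dom C f \<in> Obj C"
    and cod_obj: "f \<in> Arr C \<Longrightarrow> Cod C f \<in> Obj C"
    and ident_arr: "x \<in> Obj C \<Longrightarrow> Ident C x \<in> Arr C"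
    and dom_ident: "x \<in> Obj C \<Longrightarrow> Dom C (Ident C x) = x"
    and cod_ident: "x \<in> Obj C \<Longrightarrow> Cod C (Ident C x) = x"
    and comp_arr: "\<lbrakk>g \<in> Arr C; f \<in> Arr C; Dom C g = Cod C f\<rbrakk> \<Longrightarrow> Comp C g f \<in> Arr C"
    and dom_comp: "\<lbrakk>g \<in> Arr C; f \<in> Arr C; Dom C g = Cod C f\<rbrakk> \<Longrightarrow> Dom C (Comp C g f) = Dom C f"
    and cod_comp: "\<lbrakk>g \<in> Arr C; f \<in> Arr C; Dom C g = Cod C f\<rbrakk> \<Longrightarrow> Cod C (Comp C g f) = Cod C g"
    and comp_assoc: "\<lbrakk>h \<in> Arr C; g \<in> Arr C; f \<in> Arr C; Dom C h = Cod C g; Dom C g = Cod C f\<rbrakk>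
           \<Longrightarrow> Comp C (Comp C h g) f = Comp C h (Comp C g f)"
    and comp_ident_right: "f \<in> Arr C \<Longrightarrow> Comp C f (Ident C (Dom C f)) = f"
    and comp_ident_left: "f \<in> Arr C \<Longrightarrow> Comp C (Ident C (Cod C f)) f = f"

definition is_functor ::
  "('o, 'm) cat \<Rightarrow> ('p, 'n) cat \<Rightarrow> ('o \<Rightarrow> 'p) \<Rightarrow> ('m \<Rightarrow> 'n) \<Rightarrow> bool" where
  "is_functor C D Fo Fm \<longleftrightarrow>
     (\<forall>x \<in> Obj C. Fo x \<in> Obj D \<and> Fm (Ident C x) = Ident D (Fo x)) \<and>
     (\<forall>f \<in> Arr C. Fm f \<in> Arr D \<and> Dom D (Fm f) = Fo (Dom C f) \<and> Cod D (Fm f) = Fo (Cod C f)) \<and>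
     (\<forall>g \<in> Arr C. \<forall>f \<in> Arr C. Dom C g = Cod C f \<longrightarrow> Fm (Comp C g f) = Comp D (Fm g) (Fm f))"

definition is_iso :: "('o, 'm) cat \<Rightarrow> 'm \<Rightarrow> bool" where
  "is_iso C f \<longleftrightarrow> f \<in> Arr C \<and>
     (\<exists>g \<in> Arr C. Dom C g = Cod C f \<and> Cod C g = Dom C f \<and>
        Comp C g f = Ident C (Dom C f) \<and> Comp C f g = Ident C (Cod C f))"

definition natural_iso ::
  "('o, 'm) cat \<Rightarrow> ('p, 'n) cat \<Rightarrow> ('o \<Rightarrow> 'p) \<Rightarrow> ('m \<Rightarrow> 'n) \<Rightarrow> ('o \<Rightarrow> 'p) \<Rightarrow> ('m \<Rightarrow> 'n)
     \<Rightarrow> ('o \<Rightarrow> 'n) \<Rightarrow> bool" where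
  "natural_iso C D Fo Fm Go Gm \<eta> \<longleftrightarrow>
     (\<forall>x \<in> Obj C. is_iso D (\<eta> x) \<and> Dom D (\<eta> x) = Fo x \<and> Cod D (\<eta> x) = Go x) \<and>
     (\<forall>f \<in> Arr C. Comp D (Gm f) (\<eta> (Dom C f)) = Comp D (\<eta> (Cod C f)) (Fm f))"

definition equivalent_cats :: "('o, 'm) cat \<Rightarrow> ('p, 'n) cat \<Rightarrow> bool" where
  "equivalent_cats C D \<longleftrightarrow> cat C \<and> cat D \<and>
     (\<exists>Fo Fm Go Gm \<eta> \<epsilon>.
        is_functor C D Fo Fm \<and> is_functor D C Go Gm \<and>
        natural_iso C C id id (Go \<circ> Fo) (Gm \<circ> Fm) \<eta> \<and>
        natural_iso D D (Fo \<circ> Go) (Fm \<circ> Gm) id id \<epsilon>)"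

text \<open>The product \<open>(e, s, f) (f, t, g) = (e, s t, g)\<close> is read as ordinary composition, so
  \<open>(e, s, f)\<close> is an arrow from \<open>f\<close> to \<open>e\<close>.\<close>

definition idem_splitting :: "('a, 'b) semigroup0_scheme \<Rightarrow> ('a, 'a \<times> 'a \<times> 'a) cat" where
  "idem_splitting S = \<lparr>
     Obj = idempotents S,
     Arr = {(e, s, f). e \<in> idempotents S \<and> f \<in> idempotents S \<and>
              s \<in> {e \<cdot>\<^bsub>S\<^esub> x \<cdot>\<^bsub>S\<^esub> f | x. x \<in> carrier S}},
     Dom = (\<lambda>(e, s, f). f),
     Cod = (\<lambda>(e, s, f). e),
     Ident = (\<lambda>e. (e, e, e)),
     Comp = (\<lambda>(e, s, f) (f', t, g). (e, s \<cdot>\<^bsub>S\<^esub> t, g))\<rparr>"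

definition morita_equivalent ::
  "('a, 'b) semigroup0_scheme \<Rightarrow> ('c, 'd) semigroup0_scheme \<Rightarrow> bool" where
  "morita_equivalent S T \<longleftrightarrow> inverse_semigroup S \<and> inverse_semigroup T \<and>
     equivalent_cats (idem_splitting S) (idem_splitting T)"

section \<open>Coherent sets of idempotent representatives\<close>

definition idem_reps :: "('a, 'b) semigroup0_scheme \<Rightarrow> 'a set \<Rightarrow> bool" where
  "idem_reps S C \<longleftrightarrow> C \<subseteq> idempotents S \<and> (\<forall>v \<in> Dclasses S. \<exists>!e. e \<in> C \<and> e \<in> v)"

text \<open>\<open>rep C v\<close> is the idempotent \<open>e\<^sub>v\<close>.\<close>

definition rep :: "'a set \<Rightarrow> 'a set \<Rightarrow> 'a" where
  "rep C v = (THE e. e \<in> C \<and> e \<in> v)"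

definition coherent :: "('a, 'b) semigroup0_scheme \<Rightarrow> 'a set \<Rightarrow> bool" where
  "coherent S C \<longleftrightarrow> idem_reps S C \<and>
     (\<forall>u \<in> Dclasses S. \<forall>v \<in> Dclasses S. rep C u \<cdot>\<^bsub>S\<^esub> rep C v \<in> C) \<and>
     (\<forall>u \<in> Dclasses S. \<forall>v \<in> Dclasses S. \<forall>f \<in> idempotents S.
        rep C u \<noteq> \<zero>\<^sub>s\<^bsub>S\<^esub> \<and> nat_le S (rep C u) f \<and> nat_le S f (rep C v) \<longrightarrow> f \<in> C) \<and>
     (\<forall>v \<in> Dclasses S. \<forall>f \<in> idempotents S. \<forall>g \<in> idempotents S.
        covered_by S f (rep C v) \<and> covered_by S g (rep C v) \<and>
        \<not> nat_le S f g \<and> \<not> nat_le S g f \<longrightarrow> f \<cdot>\<^bsub>S\<^esub> g \<in> C)"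

definition class_le :: "('a, 'b) semigroup0_scheme \<Rightarrow> 'a set \<Rightarrow> 'a set \<Rightarrow> 'a set \<Rightarrow> bool" where
  "class_le S C u v \<longleftrightarrow> nat_le S (rep C u) (rep C v)"

section \<open>Labelled graph spaces and their inverse semigroups\<close>

text \<open>For an edge, \<open>head\<close> is the range map \<open>r\<close> and \<open>tail\<close> is the source map \<open>s\<close>. Since consecutive
  edges of a path satisfy \<open>s(\<lambda>\<^sub>i) = r(\<lambda>\<^sub>i\<^sub>+\<^sub>1)\<close>, paths run against the direction of the walks of
  \<open>Graph_Theory\<close>.\<close>

definition is_path :: "('v, 'e) pre_digraph \<Rightarrow> 'e list \<Rightarrow> bool" where
  "is_path G p \<longleftrightarrow> p \<noteq> [] \<and> set p \<subseteq> arcs G \<and> successively (\<lambda>x y. tail G x = head G y) p"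

definition path_range :: "('v, 'e) pre_digraph \<Rightarrow> 'e list \<Rightarrow> 'v" where
  "path_range G p = head G (hd p)"

definition path_source :: "('v, 'e) pre_digraph \<Rightarrow> 'e list \<Rightarrow> 'v" where
  "path_source G p = tail G (last p)"

text \<open>A labelled graph is a digraph \<open>G\<close> together with a labelling map \<open>L\<close> of its arcs.\<close>

definition words_of_length :: "('v, 'e) pre_digraph \<Rightarrow> ('e \<Rightarrow> 'l) \<Rightarrow> nat \<Rightarrow> 'l list set" where
  "words_of_length G L n = {map L p | p. is_path G p \<and> length p = n}"

definition words_ge1 :: "('v, 'e) pre_digraph \<Rightarrow> ('e \<Rightarrow> 'l) \<Rightarrow> 'l list set" where
  "words_ge1 G L = (\<Union>n \<in> {1..}. words_of_length G L n)"

definition words :: "('v, 'e) pre_digraph \<Rightarrow> ('e \<Rightarrow> 'l) \<Rightarrow> 'l list set" where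
  "words G L = insert [] (words_ge1 G L)"

text \<open>\<open>rel_source G L A \<alpha>\<close> is \<open>s(A, \<alpha>)\<close> and \<open>source_set G L \<alpha>\<close> is \<open>s(\<alpha>)\<close>.\<close>

definition rel_source :: "('v, 'e) pre_digraph \<Rightarrow> ('e \<Rightarrow> 'l) \<Rightarrow> 'v set \<Rightarrow> 'l list \<Rightarrow> 'v set" where
  "rel_source G L A \<alpha> = (if \<alpha> = [] then A
     else {path_source G p | p. is_path G p \<and> map L p = \<alpha> \<and> path_range G p \<in> A})"

definition source_set :: "('v, 'e) pre_digraph \<Rightarrow> ('e \<Rightarrow> 'l) \<Rightarrow> 'l list \<Rightarrow> 'v set" where
  "source_set G L \<alpha> = rel_source G L (verts G) \<alpha>"

locale labelled_graph_space = wf_digraph G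
  for G :: "('v, 'e) pre_digraph" +
  fixes L :: "'e \<Rightarrow> 'l" and B :: "'v set set"
  assumes sets_subset: "A \<in> B \<Longrightarrow> A \<subseteq> verts G"
    and Int_closed: "\<lbrakk>A \<in> B; A' \<in> B\<rbrakk> \<Longrightarrow> A \<inter> A' \<in> B"
    and rel_source_closed: "\<lbrakk>A \<in> B; \<alpha> \<in> words G L\<rbrakk> \<Longrightarrow> rel_source G L A \<alpha> \<in> B"
    and source_set_mem: "\<alpha> \<in> words_ge1 G L \<Longrightarrow> source_set G L \<alpha> \<in> B"

locale weakly_right_resolving_space = labelled_graph_space +
  assumes weakly_right_resolving: "\<lbrakk>A \<in> B; A' \<in> B; \<alpha> \<in> words_ge1 G L\<rbrakk>
    \<Longrightarrow> rel_source G L (A \<inter> A') \<alpha> = rel_source G L A \<alpha> \<inter> rel_source G L A' \<alpha>"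

text \<open>The zero of the semigroup is \<open>None\<close>; \<open>triple\<close> reads a triple with empty middle entry as zero.\<close>

type_synonym ('v, 'l) lgs_elem = "('l list \<times> 'v set \<times> 'l list) option"

definition triple :: "'l list \<Rightarrow> 'v set \<Rightarrow> 'l list \<Rightarrow> ('v, 'l) lgs_elem" where
  "triple \<alpha> A \<beta> = (if A = {} then None else Some (\<alpha>, A, \<beta>))"

fun lgs_mult :: "('v, 'e) pre_digraph \<Rightarrow> ('e \<Rightarrow> 'l) \<Rightarrow> ('v, 'l) lgs_elem \<Rightarrow> ('v, 'l) lgs_elem
    \<Rightarrow> ('v, 'l) lgs_elem" where
  "lgs_mult G L (Some (\<alpha>, A, \<beta>)) (Some (\<gamma>, B, \<delta>)) =
     (if prefix \<beta> \<gamma> then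
        (let \<gamma>' = drop (length \<beta>) \<gamma> in triple (\<alpha> @ \<gamma>') (rel_source G L A \<gamma>' \<inter> B) \<delta>)
      else if prefix \<gamma> \<beta> then
        (let \<beta>' = drop (length \<gamma>) \<beta> in triple \<alpha> (A \<inter> rel_source G L B \<beta>') (\<delta> @ \<beta>'))
      else None)"
| "lgs_mult G L None y = None"
| "lgs_mult G L (Some x) None = None"

definition lgs_semigroup :: "('v, 'e) pre_digraph \<Rightarrow> ('e \<Rightarrow> 'l) \<Rightarrow> 'v set set
    \<Rightarrow> ('v, 'l) lgs_elem semigroup0" where
  "lgs_semigroup G L B = \<lparr>
     carrier = insert None {Some (\<alpha>, A, \<beta>) | \<alpha> A \<beta>. \<alpha> \<in> words G L \<and> \<beta> \<in> words G L \<and>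
                 A \<in> B \<and> A \<noteq> {} \<and> A \<subseteq> source_set G L \<alpha> \<inter> source_set G L \<beta>},
     smult = lgs_mult G L,
     szero = None\<rparr>"

section \<open>The labelled graph space associated with a coherent set\<close>

definition coh_verts :: "('a, 'b) semigroup0_scheme \<Rightarrow> 'a set set" where
  "coh_verts S = Dclasses S - {Dclass S \<zero>\<^sub>s\<^bsub>S\<^esub>}"

definition coh_down :: "('a, 'b) semigroup0_scheme \<Rightarrow> 'a set \<Rightarrow> 'a set \<Rightarrow> 'a set set" where
  "coh_down S C v = {w \<in> coh_verts S. class_le S C w v}"

definition coh_sets :: "('a, 'b) semigroup0_scheme \<Rightarrow> 'a set \<Rightarrow> 'a set set set" where
  "coh_sets S C = insert {} {coh_down S C v | v. v \<in> coh_verts S}"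

text \<open>The edge \<open>x\<^sub>v\<^sub>,\<^sub>f\<^sub>,\<^sub>u\<close> is the triple \<open>(v, f, u)\<close>.\<close>

definition coh_graph :: "('a, 'b) semigroup0_scheme \<Rightarrow> 'a set
    \<Rightarrow> ('a set, 'a set \<times> 'a \<times> 'a set) pre_digraph" where
  "coh_graph S C = \<lparr>
     verts = coh_verts S,
     arcs = {(v, f, u). v \<in> coh_verts S \<and> f \<in> idempotents S \<and> f \<noteq> \<zero>\<^sub>s\<^bsub>S\<^esub> \<and>
               covered_by S f (rep C v) \<and> f \<noteq> rep C (Dclass S f) \<and>
               u \<in> coh_down S C (Dclass S f)},
     tail = (\<lambda>(v, f, u). u),
     head = (\<lambda>(v, f, u). v)\<rparr>"

definition coh_lab :: "'a set \<times> 'a \<times> 'a set \<Rightarrow> 'a set \<times> 'a" where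
  "coh_lab = (\<lambda>(v, f, u). (v, f))"

definition coh_semigroup :: "('a, 'b) semigroup0_scheme \<Rightarrow> 'a set
    \<Rightarrow> ('a set, 'a set \<times> 'a) lgs_elem semigroup0" where
  "coh_semigroup S C = lgs_semigroup (coh_graph S C) coh_lab (coh_sets S C)"

subsection \<open>Well-formedness\<close>

context inverse_semigroup
begin

lemma idemD: "e \<in> idempotents S \<Longrightarrow> e \<in> carrier S" "e \<in> idempotents S \<Longrightarrow> e \<cdot> e = e"
  by (auto simp: idempotents_def)

lemma inverse_eq:
  assumes "x \<in> carrier S" "y \<in> carrier S" "z \<in> carrier S"
    and "x \<cdot> y \<cdot> x = x" "y \<cdot> x \<cdot> y = y" "x \<cdot> z \<cdot> x = x" "z \<cdot> x \<cdot> z = z"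
  shows "y = z"
proof -
  let ?P = "\<lambda>y. y \<in> carrier S \<and> x \<cdot> y \<cdot> x = x \<and> y \<cdot> x \<cdot> y = y"
  have "?P y" "?P z" using assms by simp_all
  then show ?thesis
    using the1_equality[OF unique_inverse[OF assms(1)], of y]
      the1_equality[OF unique_inverse[OF assms(1)], of z] by simp
qed

lemma idem_mult_idem:
  assumes e: "e \<in> idempotents S" and f: "f \<in> idempotents S"
  shows "e \<cdot> f \<in> idempotents S"
proof -
  note ef [simp] = idemD[OF e] idemD[OF f]
  note [simp] = mult_closed mult_assoc
  have absE [simp]: "e \<cdot> (e \<cdot> z) = e \<cdot> z" if "z \<in> carrier S" for z
    by (simp only: mult_assoc[OF ef(1) ef(1) that, symmetric] ef(2))
  have absF [simp]: "f \<cdot> (f \<cdot> z) = f \<cdot> z" if "z \<in> carrier S" for z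
    by (simp only: mult_assoc[OF ef(3) ef(3) that, symmetric] ef(4))
  obtain x where x [simp]: "x \<in> carrier S"
    and x1: "(e \<cdot> f) \<cdot> x \<cdot> (e \<cdot> f) = e \<cdot> f" and x2: "x \<cdot> (e \<cdot> f) \<cdot> x = x"
    using unique_inverse[OF mult_closed[OF ef(1) ef(3)]] by blast
  have x1': "e \<cdot> (f \<cdot> (x \<cdot> (e \<cdot> f))) = e \<cdot> f" using x1 by simp
  have x2': "x \<cdot> (e \<cdot> (f \<cdot> x)) = x" using x2 by simp
  have x2'': "x \<cdot> (e \<cdot> (f \<cdot> (x \<cdot> e))) = x \<cdot> e"
    using arg_cong[OF x2', of "\<lambda>t. t \<cdot> e"] by simp
  have fxe: "f \<cdot> x \<cdot> e = x"
    by (rule inverse_eq[of "e \<cdot> f"]) (use x1' x2' x2'' in simp_all)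
  have "(f \<cdot> x \<cdot> e) \<cdot> (f \<cdot> x \<cdot> e) = f \<cdot> x \<cdot> e" using x2'' by simp
  then have xx: "x \<cdot> x = x" unfolding fxe .
  have "e \<cdot> f = x"
    by (rule inverse_eq[of x]) (use x1' x2' xx in simp_all)
  then show ?thesis using xx by (simp add: idempotents_def)
qed

lemma idem_commute:
  assumes e: "e \<in> idempotents S" and f: "f \<in> idempotents S"
  shows "e \<cdot> f = f \<cdot> e"
proof -
  note ef [simp] = idemD[OF e] idemD[OF f]
  note [simp] = mult_closed mult_assoc
  have absE [simp]: "e \<cdot> (e \<cdot> z) = e \<cdot> z" if "z \<in> carrier S" for z
    by (simp only: mult_assoc[OF ef(1) ef(1) that, symmetric] ef(2))
  have absF [simp]: "f \<cdot> (f \<cdot> z) = f \<cdot> z" if "z \<in> carrier S" for z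
    by (simp only: mult_assoc[OF ef(3) ef(3) that, symmetric] ef(4))
  have p: "e \<cdot> (f \<cdot> (e \<cdot> f)) = e \<cdot> f" "f \<cdot> (e \<cdot> (f \<cdot> e)) = f \<cdot> e"
    using idemD(2)[OF idem_mult_idem[OF e f]] idemD(2)[OF idem_mult_idem[OF f e]] by simp_all
  show ?thesis
    by (rule inverse_eq[of "e \<cdot> f"]) (use p in simp_all)
qed

lemma nat_le_idem_iff:
  assumes "e \<in> idempotents S" "f \<in> idempotents S"
  shows "nat_le S e f \<longleftrightarrow> e \<cdot> f = e"
proof
  note ef = idemD[OF assms(1)] idemD[OF assms(2)]
  assume "nat_le S e f"
  then obtain k where k: "k \<in> idempotents S" "e = k \<cdot> f" by (auto simp: nat_le_def)
  have "k \<cdot> f \<cdot> f = k \<cdot> f" using idemD(1)[OF k(1)] ef by (simp add: mult_assoc)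
  then show "e \<cdot> f = e" using k by simp
next
  assume "e \<cdot> f = e"
  then show "nat_le S e f"
    unfolding nat_le_def using assms idemD(1) by (auto intro!: bexI[of _ e])
qed

lemma left_unit: assumes "s \<in> carrier S" shows "\<exists>x \<in> carrier S. s = x \<cdot> s"
proof -
  obtain y where "y \<in> carrier S" "s \<cdot> y \<cdot> s = s"
    using ex1_implies_ex[OF unique_inverse[OF assms]] by blast
  then show ?thesis using assms mult_closed by (intro bexI[of _ "s \<cdot> y"]) simp_all
qed

lemma right_unit: assumes "s \<in> carrier S" shows "\<exists>x \<in> carrier S. s = s \<cdot> x"
proof -
  obtain y where "y \<in> carrier S" "s \<cdot> y \<cdot> s = s"
    using ex1_implies_ex[OF unique_inverse[OF assms]] by blast
  then show ?thesis using assms mult_closed mult_assoc by (intro bexI[of _ "y \<cdot> s"]) simp_all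
qed

lemma greenL_iff:
  "(s, t) \<in> greenL S \<longleftrightarrow> s \<in> carrier S \<and> t \<in> carrier S \<and>
     (\<exists>x \<in> carrier S. t = x \<cdot> s) \<and> (\<exists>x \<in> carrier S. s = x \<cdot> t)"
proof (cases "s \<in> carrier S \<and> t \<in> carrier S")
  case True
  then have *: "insert s {x \<cdot> s | x. x \<in> carrier S} = {x \<cdot> s | x. x \<in> carrier S}"
    "insert t {x \<cdot> t | x. x \<in> carrier S} = {x \<cdot> t | x. x \<in> carrier S}"
    using left_unit by blast+
  show ?thesis
  proof
    assume "(s, t) \<in> greenL S"
    then show "s \<in> carrier S \<and> t \<in> carrier S \<and>
      (\<exists>x \<in> carrier S. t = x \<cdot> s) \<and> (\<exists>x \<in> carrier S. s = x \<cdot> t)"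
      unfolding greenL_def using * True by blast
  next
    assume "s \<in> carrier S \<and> t \<in> carrier S \<and>
      (\<exists>x \<in> carrier S. t = x \<cdot> s) \<and> (\<exists>x \<in> carrier S. s = x \<cdot> t)"
    then obtain x y where xy: "x \<in> carrier S" "y \<in> carrier S" "t = x \<cdot> s" "s = y \<cdot> t" by blast
    have "{x \<cdot> s | x. x \<in> carrier S} \<subseteq> {x \<cdot> t | x. x \<in> carrier S}"
      using xy True by clarsimp (metis mult_assoc mult_closed)
    moreover have "{x \<cdot> t | x. x \<in> carrier S} \<subseteq> {x \<cdot> s | x. x \<in> carrier S}"
      using xy True by clarsimp (metis mult_assoc mult_closed)
    ultimately show "(s, t) \<in> greenL S"
      unfolding greenL_def using * True by simp
  qed
qed (auto simp: greenL_def)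

lemma greenR_iff:
  "(s, t) \<in> greenR S \<longleftrightarrow> s \<in> carrier S \<and> t \<in> carrier S \<and>
     (\<exists>x \<in> carrier S. t = s \<cdot> x) \<and> (\<exists>x \<in> carrier S. s = t \<cdot> x)"
proof (cases "s \<in> carrier S \<and> t \<in> carrier S")
  case True
  then have *: "insert s {s \<cdot> x | x. x \<in> carrier S} = {s \<cdot> x | x. x \<in> carrier S}"
    "insert t {t \<cdot> x | x. x \<in> carrier S} = {t \<cdot> x | x. x \<in> carrier S}"
    using right_unit by blast+
  show ?thesis
  proof
    assume "(s, t) \<in> greenR S"
    then show "s \<in> carrier S \<and> t \<in> carrier S \<and>
      (\<exists>x \<in> carrier S. t = s \<cdot> x) \<and> (\<exists>x \<in> carrier S. s = t \<cdot> x)"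
      unfolding greenR_def using * True by blast
  next
    assume "s \<in> carrier S \<and> t \<in> carrier S \<and>
      (\<exists>x \<in> carrier S. t = s \<cdot> x) \<and> (\<exists>x \<in> carrier S. s = t \<cdot> x)"
    then obtain x y where xy: "x \<in> carrier S" "y \<in> carrier S" "t = s \<cdot> x" "s = t \<cdot> y" by blast
    have "{s \<cdot> x | x. x \<in> carrier S} \<subseteq> {t \<cdot> x | x. x \<in> carrier S}"
      using xy True by clarsimp (metis mult_assoc mult_closed)
    moreover have "{t \<cdot> x | x. x \<in> carrier S} \<subseteq> {s \<cdot> x | x. x \<in> carrier S}"
      using xy True by clarsimp (metis mult_assoc mult_closed)
    ultimately show "(s, t) \<in> greenR S"
      unfolding greenR_def using * True by simp
  qed
qed (auto simp: greenR_def)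

lemma greenLR_commute: "greenL S O greenR S = greenR S O greenL S"
proof (intro equalityI subrelI)
  fix a b assume "(a, b) \<in> greenL S O greenR S"
  then obtain c u v y z where *: "a \<in> carrier S" "b \<in> carrier S" "c \<in> carrier S"
    "u \<in> carrier S" "v \<in> carrier S" "y \<in> carrier S" "z \<in> carrier S"
    "c = u \<cdot> a" "a = v \<cdot> c" "b = c \<cdot> y" "c = b \<cdot> z"
    unfolding greenL_iff greenR_iff relcomp_unfold by blast
  have e1: "v \<cdot> b = a \<cdot> y"
    using *(9,10) mult_assoc[OF *(5,3,6)] by simp
  have e2: "a = (a \<cdot> y) \<cdot> z"
    using *(9,11) e1 mult_assoc[OF *(5,2,7)] by simp
  have e3: "u \<cdot> (a \<cdot> y) = b"
    using *(8,10) mult_assoc[OF *(4,1,6)] by simp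
  have "(a, a \<cdot> y) \<in> greenR S"
    unfolding greenR_iff using * e2 mult_closed by blast
  moreover have "(a \<cdot> y, b) \<in> greenL S"
    unfolding greenL_iff using * e1[symmetric] e3[symmetric] mult_closed by blast
  ultimately show "(a, b) \<in> greenR S O greenL S" by blast
next
  fix a b assume "(a, b) \<in> greenR S O greenL S"
  then obtain c u v y z where *: "a \<in> carrier S" "b \<in> carrier S" "c \<in> carrier S"
    "u \<in> carrier S" "v \<in> carrier S" "y \<in> carrier S" "z \<in> carrier S"
    "c = a \<cdot> u" "a = c \<cdot> v" "b = y \<cdot> c" "c = z \<cdot> b"
    unfolding greenL_iff greenR_iff relcomp_unfold by blast
  have e1: "b \<cdot> v = y \<cdot> a"
    using *(9,10) mult_assoc[OF *(6,3,5)] by simp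
  have e2: "a = z \<cdot> (y \<cdot> a)"
    using *(9,11) e1 mult_assoc[OF *(7,2,5)] by simp
  have e3: "(y \<cdot> a) \<cdot> u = b"
    using *(8,10) mult_assoc[OF *(6,1,4)] by simp
  have "(a, y \<cdot> a) \<in> greenL S"
    unfolding greenL_iff using * e2 mult_closed by blast
  moreover have "(y \<cdot> a, b) \<in> greenR S"
    unfolding greenR_iff using * e1[symmetric] e3[symmetric] mult_closed by blast
  ultimately show "(a, b) \<in> greenL S O greenR S" by blast
qed

lemma greenD_equiv: "equiv (carrier S) (greenD S)"
proof (rule equivI)
  have sL: "(b, a) \<in> greenL S" if "(a, b) \<in> greenL S" for a b
    using that by (auto simp: greenL_def)
  have sR: "(b, a) \<in> greenR S" if "(a, b) \<in> greenR S" for a b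
    using that by (auto simp: greenR_def)
  have tL: "(a, c) \<in> greenL S" if "(a, b) \<in> greenL S" "(b, c) \<in> greenL S" for a b c
    using that by (auto simp: greenL_def)
  have tR: "(a, c) \<in> greenR S" if "(a, b) \<in> greenR S" "(b, c) \<in> greenR S" for a b c
    using that by (auto simp: greenR_def)
  show "refl_on (carrier S) (greenD S)"
    by (auto simp: refl_on_def greenD_def greenL_def greenR_def)
  show "greenD S \<subseteq> carrier S \<times> carrier S"
    by (auto simp: greenD_def greenL_def greenR_def)
  show "sym (greenD S)"
  proof (rule symI)
    fix a b assume "(a, b) \<in> greenD S"
    then have "(b, a) \<in> greenR S O greenL S"
      unfolding greenD_def using sL sR by blast
    then show "(b, a) \<in> greenD S" by (simp add: greenD_def greenLR_commute)
  qed
  show "trans (greenD S)"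
  proof (rule transI)
    fix a b c assume "(a, b) \<in> greenD S" "(b, c) \<in> greenD S"
    then obtain p q where p: "(a, p) \<in> greenL S" "(p, b) \<in> greenR S"
      and q: "(b, q) \<in> greenL S" "(q, c) \<in> greenR S"
      unfolding greenD_def by blast
    have "(p, q) \<in> greenR S O greenL S" using p q by blast
    then have "(p, q) \<in> greenL S O greenR S" by (simp add: greenLR_commute)
    then show "(a, c) \<in> greenD S"
      unfolding greenD_def using p q tL tR by blast
  qed
qed

lemma cat_idem_splitting: "cat (idem_splitting S)"
proof
  fix x assume "x \<in> Obj (idem_splitting S)"
  then show "Ident (idem_splitting S) x \<in> Arr (idem_splitting S)"
    by (auto simp: idem_splitting_def idempotents_def intro!: exI[of _ x])
next
  fix g f assume gf: "g \<in> Arr (idem_splitting S)" "f \<in> Arr (idem_splitting S)"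
    "Dom (idem_splitting S) g = Cod (idem_splitting S) f"
  then obtain e h k x y where *: "g = (e, e \<cdot> x \<cdot> h, h)" "f = (h, h \<cdot> y \<cdot> k, k)"
    "e \<in> idempotents S" "h \<in> idempotents S" "k \<in> idempotents S" "x \<in> carrier S" "y \<in> carrier S"
    by (auto simp: idem_splitting_def)
  have "e \<cdot> x \<cdot> h \<cdot> (h \<cdot> y \<cdot> k) = e \<cdot> (x \<cdot> h \<cdot> (h \<cdot> y)) \<cdot> k" "x \<cdot> h \<cdot> (h \<cdot> y) \<in> carrier S"
    using * idemD by (simp_all add: mult_assoc mult_closed)
  then show "Comp (idem_splitting S) g f \<in> Arr (idem_splitting S)"
    using * by (auto simp: idem_splitting_def)
next
  fix f assume "f \<in> Arr (idem_splitting S)"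
  then obtain e k x where *: "f = (e, e \<cdot> x \<cdot> k, k)"
    "e \<in> idempotents S" "k \<in> idempotents S" "x \<in> carrier S"
    by (auto simp: idem_splitting_def)
  note c = idemD(1)[OF *(2)] idemD(1)[OF *(3)] *(4)
  have "e \<cdot> (e \<cdot> x) = e \<cdot> x"
    by (simp only: mult_assoc[OF c(1,1,3), symmetric] idemD(2)[OF *(2)])
  then have "e \<cdot> (e \<cdot> x \<cdot> k) = e \<cdot> x \<cdot> k"
    by (simp only: mult_assoc[OF c(1) mult_closed[OF c(1,3)] c(2), symmetric])
  moreover have "e \<cdot> x \<cdot> k \<cdot> k = e \<cdot> x \<cdot> k"
    by (simp only: mult_assoc[OF mult_closed[OF c(1,3)] c(2,2)] idemD(2)[OF *(3)])
  ultimately show "Comp (idem_splitting S) f (Ident (idem_splitting S) (Dom (idem_splitting S) f)) = f"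
    "Comp (idem_splitting S) (Ident (idem_splitting S) (Cod (idem_splitting S) f)) f = f"
    using * by (auto simp: idem_splitting_def)
qed (auto simp: idem_splitting_def mult_assoc mult_closed idemD)

end

context inverse_semigroup0
begin

lemma Dclass_mem: "s \<in> carrier S \<Longrightarrow> Dclass S s \<in> Dclasses S" "s \<in> carrier S \<Longrightarrow> s \<in> Dclass S s"
  unfolding Dclass_def Dclasses_def
  by (simp add: quotientI, rule equiv_class_self[OF greenD_equiv])

lemma Dclass_zero: "Dclass S \<zero>\<^sub>s = {\<zero>\<^sub>s}"
proof -
  have "b = \<zero>\<^sub>s" if b: "(\<zero>\<^sub>s, b) \<in> greenD S" for b
  proof -
    obtain c where c: "(\<zero>\<^sub>s, c) \<in> greenL S" "(c, b) \<in> greenR S"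
      using b unfolding greenD_def by (rule relcompEpair)
    then obtain x y where "x \<in> carrier S" "c = x \<cdot> \<zero>\<^sub>s" "y \<in> carrier S" "b = c \<cdot> y"
      unfolding greenL_iff greenR_iff by blast
    then show ?thesis by (simp add: zero_left zero_right)
  qed
  then show ?thesis using Dclass_mem(2)[OF zero_closed] by (auto simp: Dclass_def)
qed

context
  fixes C assumes coh: "coherent S C"
begin

lemma reps:
  shows reps_idem: "C \<subseteq> idempotents S"
    and reps_ex1: "v \<in> Dclasses S \<Longrightarrow> \<exists>!e. e \<in> C \<and> e \<in> v"
proof -
  have "idem_reps S C" by (rule coh[unfolded coherent_def, THEN conjunct1])
  note * = this[unfolded idem_reps_def]
  show "C \<subseteq> idempotents S" by (rule *[THEN conjunct1])
  show "v \<in> Dclasses S \<Longrightarrow> \<exists>!e. e \<in> C \<and> e \<in> v" by (rule *[THEN conjunct2, THEN bspec])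
qed

lemma reps_mult:
  assumes "u \<in> Dclasses S" "v \<in> Dclasses S" shows "rep C u \<cdot> rep C v \<in> C"
  by (rule coh[unfolded coherent_def, THEN conjunct2, THEN conjunct1, THEN bspec, THEN bspec,
        OF assms])

lemma rep_mem:
  assumes "v \<in> Dclasses S" shows "rep C v \<in> C" "rep C v \<in> v" "rep C v \<in> idempotents S"
proof -
  have "rep C v \<in> C \<and> rep C v \<in> v"
    unfolding rep_def by (rule theI'[OF reps_ex1[OF assms]])
  then show "rep C v \<in> C" "rep C v \<in> v" "rep C v \<in> idempotents S"
    using subsetD[OF reps_idem] by simp_all
qed

lemma rep_Dclass: assumes "e \<in> C" shows "rep C (Dclass S e) = e"
proof -
  have e: "e \<in> carrier S" using subsetD[OF reps_idem assms] by (rule idemD(1))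
  show ?thesis
    unfolding rep_def
    by (rule the1_equality[OF reps_ex1[OF Dclass_mem(1)[OF e]]])
      (use assms Dclass_mem(2)[OF e] in simp)
qed

lemma Dclass_rep: assumes "v \<in> Dclasses S" shows "Dclass S (rep C v) = v"
proof -
  obtain s where s: "v = greenD S `` {s}" "s \<in> carrier S"
    using assms unfolding Dclasses_def by (rule quotientE)
  have "rep C v \<in> greenD S `` {s}" using rep_mem(2)[OF assms] unfolding s(1)[symmetric] .
  then have "(s, rep C v) \<in> greenD S" by (rule ImageE) simp
  then show ?thesis
    unfolding Dclass_def by (rule trans[OF equiv_class_eq[OF greenD_equiv, symmetric] s(1)[symmetric]])
qed

lemma coh_vert_iff: "v \<in> coh_verts S \<longleftrightarrow> v \<in> Dclasses S \<and> rep C v \<noteq> \<zero>\<^sub>s"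
proof -
  have "v = Dclass S \<zero>\<^sub>s \<longleftrightarrow> rep C v = \<zero>\<^sub>s" if v: "v \<in> Dclasses S"
  proof
    assume "v = Dclass S \<zero>\<^sub>s"
    then show "rep C v = \<zero>\<^sub>s" using rep_mem(2)[OF v] unfolding Dclass_zero by simp
  next
    assume "rep C v = \<zero>\<^sub>s"
    then show "v = Dclass S \<zero>\<^sub>s" using Dclass_rep[OF v] by simp
  qed
  then show ?thesis by (auto simp: coh_verts_def)
qed

lemma class_le_iff:
  "\<lbrakk>u \<in> Dclasses S; v \<in> Dclasses S\<rbrakk> \<Longrightarrow> class_le S C u v \<longleftrightarrow> rep C u \<cdot> rep C v = rep C u"
  unfolding class_le_def by (rule nat_le_idem_iff[OF rep_mem(3) rep_mem(3)])

lemma coh_down_Int: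
  assumes "u \<in> coh_verts S" "v \<in> coh_verts S"
  shows "coh_down S C u \<inter> coh_down S C v \<in> coh_sets S C"
proof -
  have uv: "u \<in> Dclasses S" "v \<in> Dclasses S" using assms by (auto simp: coh_vert_iff)
  define w where "w = Dclass S (rep C u \<cdot> rep C v)"
  have "rep C u \<cdot> rep C v \<in> C" using uv by (rule reps_mult)
  then have rw: "rep C w = rep C u \<cdot> rep C v" unfolding w_def by (rule rep_Dclass)
  have w: "w \<in> Dclasses S"
    unfolding w_def
    by (intro Dclass_mem(1) mult_closed idemD(1) rep_mem(3) uv)
  have le: "class_le S C x w \<longleftrightarrow> class_le S C x u \<and> class_le S C x v" if x: "x \<in> Dclasses S" for x
  proof -
    define a b c where abc: "a = rep C x" "b = rep C u" "c = rep C v"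
    have i: "a \<in> idempotents S" "b \<in> idempotents S" "c \<in> idempotents S"
      using rep_mem(3) x uv by (simp_all add: abc)
    note c = i[THEN idemD(1)]
    have "a \<cdot> b = a \<and> a \<cdot> c = a" if h: "a \<cdot> (b \<cdot> c) = a"
    proof
      have "a \<cdot> (b \<cdot> c) \<cdot> c = a \<cdot> (b \<cdot> c)"
        by (simp only: mult_assoc[OF c(1) mult_closed[OF c(2,3)] c(3)] mult_assoc[OF c(2,3,3)]
            idemD(2)[OF i(3)])
      then show "a \<cdot> c = a" using h by simp
      have "a \<cdot> (c \<cdot> b) \<cdot> b = a \<cdot> (c \<cdot> b)"
        by (simp only: mult_assoc[OF c(1) mult_closed[OF c(3,2)] c(2)] mult_assoc[OF c(3,2,2)]
            idemD(2)[OF i(2)])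
      then show "a \<cdot> b = a" using h idem_commute[OF i(2,3)] by simp
    qed
    moreover have "a \<cdot> (b \<cdot> c) = a" if "a \<cdot> b = a" "a \<cdot> c = a"
      using that mult_assoc[OF c] by simp
    ultimately show ?thesis
      unfolding class_le_iff[OF x w] class_le_iff[OF x uv(1)] class_le_iff[OF x uv(2)] rw
        abc[symmetric] by blast
  qed
  show ?thesis
  proof (cases "w \<in> coh_verts S")
    case True
    have "coh_down S C u \<inter> coh_down S C v = coh_down S C w"
      unfolding coh_down_def using le by (auto simp: coh_vert_iff)
    then show ?thesis using True by (auto simp: coh_sets_def)
  next
    case False
    then have "rep C w = \<zero>\<^sub>s" using w by (simp add: coh_vert_iff)
    have "\<not> class_le S C x w" if x: "x \<in> coh_verts S" for x
    proof -
      have x': "x \<in> Dclasses S" "rep C x \<noteq> \<zero>\<^sub>s" using x by (simp_all add: coh_vert_iff)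
      show ?thesis
        unfolding class_le_iff[OF x'(1) w] \<open>rep C w = \<zero>\<^sub>s\<close>
        using x'(2) zero_right[OF idemD(1)[OF rep_mem(3)[OF x'(1)]]] by simp
    qed
    then have "coh_down S C u \<inter> coh_down S C v = {}"
      unfolding coh_down_def using le by (auto simp: coh_vert_iff)
    then show ?thesis by (simp add: coh_sets_def)
  qed
qed

lemma coh_rel_source:
  assumes "is_path (coh_graph S C) p"
  shows "rel_source (coh_graph S C) coh_lab A (map coh_lab p) =
     (if head (coh_graph S C) (hd p) \<in> A then coh_down S C (Dclass S (fst (snd (last p)))) else {})"
    (is "?l = ?r")
proof (intro equalityI subsetI)
  fix u assume "u \<in> ?l"
  then obtain q where q: "is_path (coh_graph S C) q" "map coh_lab q = map coh_lab p"
    "head (coh_graph S C) (hd q) \<in> A" "u = tail (coh_graph S C) (last q)"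
    using assms by (auto simp: rel_source_def path_range_def path_source_def is_path_def)
  have ne: "p \<noteq> []" "q \<noteq> []" using assms q by (auto simp: is_path_def)
  have "coh_lab (hd q) = coh_lab (hd p)" "coh_lab (last q) = coh_lab (last p)"
    using ne q(2) by (metis hd_map, metis last_map)
  moreover have "last q \<in> arcs (coh_graph S C)" using q ne by (auto simp: is_path_def)
  ultimately show "u \<in> ?r"
    using q by (auto simp: coh_graph_def coh_lab_def split: prod.splits)
next
  fix u assume u: "u \<in> ?r"
  have ne: "p \<noteq> []" using assms by (auto simp: is_path_def)
  obtain v f x where l: "last p = (v, f, x)" by (metis prod_cases3)
  define q where "q = butlast p @ [(v, f, u)]"
  have p: "p = butlast p @ [(v, f, x)]" using ne l by (metis append_butlast_last_id)
  have hA: "head (coh_graph S C) (hd p) \<in> A" and u': "u \<in> coh_down S C (Dclass S f)"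
    using u l by (auto split: if_splits)
  have "(v, f, x) \<in> arcs (coh_graph S C)" "set (butlast p) \<subseteq> arcs (coh_graph S C)"
    using assms ne l unfolding is_path_def by (metis last_in_set subsetD, metis in_set_butlastD subset_iff)
  then have "set q \<subseteq> arcs (coh_graph S C)"
    using u' by (auto simp: q_def coh_graph_def)
  moreover have "successively (\<lambda>x y. tail (coh_graph S C) x = head (coh_graph S C) y) q"
  proof -
    have "successively (\<lambda>x y. tail (coh_graph S C) x = head (coh_graph S C) y)
        (butlast p @ [(v, f, x)])"
      using assms p by (auto simp: is_path_def)
    then show ?thesis
      unfolding q_def successively_append_iff by (simp add: coh_graph_def)
  qed
  ultimately have "is_path (coh_graph S C) q" by (simp add: is_path_def q_def)
  moreover have "map coh_lab q = map coh_lab p"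
    by (rule trans[OF _ arg_cong[OF p[symmetric]]]) (simp add: q_def coh_lab_def)
  moreover have "head (coh_graph S C) (hd q) = head (coh_graph S C) (hd p)"
  proof -
    have "head (coh_graph S C) (hd (butlast p @ [(v, f, x)])) = head (coh_graph S C) (hd q)"
      unfolding q_def by (cases "butlast p") (simp_all add: coh_graph_def)
    then show ?thesis unfolding p[symmetric] by simp
  qed
  moreover have "tail (coh_graph S C) (last q) = u" by (simp add: q_def coh_graph_def)
  ultimately show "u \<in> ?l"
    using ne hA by (auto simp: rel_source_def path_range_def path_source_def intro!: exI[of _ q])
qed

lemma coh_rel_source_mem:
  assumes "is_path (coh_graph S C) p"
  shows "rel_source (coh_graph S C) coh_lab A (map coh_lab p) \<in> coh_sets S C"
proof -
  have "last p \<in> arcs (coh_graph S C)" using assms by (auto simp: is_path_def)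
  then obtain f where f: "f = fst (snd (last p))" "f \<in> idempotents S" "f \<noteq> \<zero>\<^sub>s"
    by (auto simp: coh_graph_def)
  then have "Dclass S f \<in> coh_verts S"
    unfolding coh_verts_def using Dclass_mem[of f] idemD Dclass_zero by auto
  then show ?thesis
    unfolding coh_rel_source[OF assms] f(1)[symmetric] by (auto simp: coh_sets_def)
qed

theorem weakly_right_resolving_coh:
  "weakly_right_resolving_space (coh_graph S C) coh_lab (coh_sets S C)"
proof
  fix e assume e: "e \<in> arcs (coh_graph S C)"
  then show "tail (coh_graph S C) e \<in> verts (coh_graph S C)"
    "head (coh_graph S C) e \<in> verts (coh_graph S C)"
    by (auto simp: coh_graph_def coh_down_def)
next
  fix A assume "A \<in> coh_sets S C"
  then show "A \<subseteq> verts (coh_graph S C)"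
    by (auto simp: coh_sets_def coh_graph_def coh_down_def)
next
  fix A A' assume "A \<in> coh_sets S C" "A' \<in> coh_sets S C"
  then show "A \<inter> A' \<in> coh_sets S C"
    unfolding coh_sets_def[of S C] using coh_down_Int
    by (auto simp: coh_sets_def)
next
  fix A \<alpha> assume "A \<in> coh_sets S C" "\<alpha> \<in> words (coh_graph S C) coh_lab"
  then show "rel_source (coh_graph S C) coh_lab A \<alpha> \<in> coh_sets S C"
    unfolding words_def words_ge1_def words_of_length_def using coh_rel_source_mem
    by (auto simp: rel_source_def[where \<alpha> = "[]"])
next
  fix \<alpha> assume "\<alpha> \<in> words_ge1 (coh_graph S C) coh_lab"
  then show "source_set (coh_graph S C) coh_lab \<alpha> \<in> coh_sets S C"
    unfolding words_ge1_def words_of_length_def source_set_def using coh_rel_source_mem by auto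
next
  fix A A' \<alpha> assume "\<alpha> \<in> words_ge1 (coh_graph S C) coh_lab"
  then obtain p where "is_path (coh_graph S C) p" "\<alpha> = map coh_lab p"
    by (auto simp: words_ge1_def words_of_length_def)
  then show "rel_source (coh_graph S C) coh_lab (A \<inter> A') \<alpha> =
      rel_source (coh_graph S C) coh_lab A \<alpha> \<inter> rel_source (coh_graph S C) coh_lab A' \<alpha>"
    by (auto simp: coh_rel_source)
qed

end

end

end

theory Submission
  imports Defs
begin

text \<open>Write \<open>t\<^sub>f\<close> for the element of \<open>S\<close> with \<open>t\<^sub>f\<^sup>* t\<^sub>f = e\<^bsub>[f]\<^esub>\<close> and
  \<open>t\<^sub>f t\<^sub>f\<^sup>* = f\<close>. A word \<open>\<alpha> = (v\<^sub>1, f\<^sub>1) \<dots> (v\<^sub>n, f\<^sub>n)\<close> of the labelled graph gives the product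
  \<open>T\<^sub>\<alpha> = t\<^bsub>f\<^sub>1\<^esub> \<cdots> t\<^bsub>f\<^sub>n\<^esub>\<close> (acting as an identity if \<open>\<alpha>\<close> is empty), and the map \<open>\<phi>(\<alpha>, B\<^sub>w, \<beta>) = T\<^sub>\<alpha> e\<^sub>w T\<^sub>\<beta>\<^sup>*\<close>, \<open>\<phi>(0) = 0\<close>,
  is an injective homomorphism from the labelled graph inverse semigroup into \<open>S\<close>.
  Its image consists of the elements \<open>s\<close> for which \<open>s s\<^sup>*\<close> and \<open>s\<^sup>* s\<close> lie below idempotents of \<open>C\<close>.
  This image contains all products \<open>e s f\<close> with \<open>e\<close> and \<open>f\<close> idempotents of the image, and
  each idempotent of \<open>S\<close> is \<open>\<D>\<close>-related to one of them, namely to the one in \<open>C\<close>. So \<open>\<phi>\<close> induces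
  a fully faithful and essentially surjective functor of the idempotent splittings
  (\<open>morita_equivalent_of_embedding\<close>); associativity and unique inverses of the labelled graph
  inverse semigroup are inherited from \<open>S\<close> along \<open>\<phi>\<close>.

  Coherence enters through two facts on labels. A label \<open>(v, f)\<close> is a place at which a chain of
  covers that descends from \<open>e\<^sub>v\<close> leaves \<open>C\<close>: \<open>f \<lless> e\<^sub>v\<close> is not in \<open>C\<close>. Then no nonzero element of
  \<open>C\<close> lies below \<open>f\<close>, and as intervals
  are finite this forces \<open>c f = 0\<close> for every \<open>c \<in> C\<close> with \<open>e\<^sub>v \<not>\<le> c\<close>
  (\<open>exit_mult_C\<close>), and \<open>f g = 0\<close> for distinct labels \<open>(v, f)\<close> and \<open>(u, g)\<close> (\<open>exit_disjoint\<close>).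
  The first fact matches the condition under which \<open>s(B\<^sub>w, \<alpha>)\<close> is empty, the second matches the zero
  product of triples with incomparable words; together they make \<open>\<phi>\<close> a homomorphism.

  For injectivity, if \<open>T\<^sub>\<alpha> e\<^sub>w T\<^sub>\<alpha>\<^sup>*\<close> equals \<open>T\<^sub>\<beta> e\<^sub>x T\<^sub>\<beta>\<^sup>*\<close>, then the words are comparable, and a proper
  extension would put \<open>e\<^sub>w\<close> below the first \<open>f\<close> of the excess. For the image, an idempotent
  \<open>h \<noteq> 0\<close> below \<open>e \<in> C\<close> is reached by a word: follow a finite chain of covers from \<open>e\<close> down to \<open>h\<close>,
  and each time it leaves \<open>C\<close> at some \<open>f\<close>, write the letter down and transport the rest of the chain
  along \<open>t\<^sub>f\<close> to a chain below \<open>e\<^bsub>[f]\<^esub> \<in> C\<close> (\<open>idem_reached\<close>). As \<open>S\<close> is combinatorial, an element is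
  determined by the two idempotents \<open>s s\<^sup>*\<close> and \<open>s\<^sup>* s\<close>, so reaching these is enough to reach \<open>s\<close>.\<close>

section \<open>Fully faithful, essentially surjective functors\<close>

text \<open>Choose an isomorphism \<open>h\<^sub>x\<close> from each object \<open>x\<close> to an object \<open>G (F x)\<close>. An arrow \<open>f\<close> is sent to
  the unique lift of \<open>h f h\<^sup>-\<^sup>1\<close> along \<open>G\<close>. Then \<open>h\<close> is one of the natural isomorphisms, and the other
  one consists of the lifts of the inverses of \<open>h\<close>.\<close>

lemma equivalent_cats_of_fully_faithful:
  assumes C: "cat C" and D: "cat D" and G: "is_functor D C Go Gm"
    and faithful: "\<And>m m'. \<lbrakk>m \<in> Arr D; m' \<in> Arr D; Dom D m = Dom D m'; Cod D m = Cod D m';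
          Gm m = Gm m'\<rbrakk> \<Longrightarrow> m = m'"
    and full: "\<And>a b f. \<lbrakk>a \<in> Obj D; b \<in> Obj D; f \<in> Arr C; Dom C f = Go a; Cod C f = Go b\<rbrakk>
          \<Longrightarrow> \<exists>m \<in> Arr D. Dom D m = a \<and> Cod D m = b \<and> Gm m = f"
    and ess_surj: "\<And>x. x \<in> Obj C \<Longrightarrow> \<exists>a \<in> Obj D. \<exists>f. is_iso C f \<and> Dom C f = x \<and> Cod C f = Go a"
  shows "equivalent_cats C D"
proof -
  interpret C: cat C by (rule C)
  interpret D: cat D by (rule D)
  have Go [simp]: "Go a \<in> Obj C" "Gm (Ident D a) = Ident C (Go a)" if "a \<in> Obj D" for a
    using G that by (simp_all add: is_functor_def)
  have Gm [simp]: "Gm m \<in> Arr C" "Dom C (Gm m) = Go (Dom D m)" "Cod C (Gm m) = Go (Cod D m)"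
    if "m \<in> Arr D" for m
    using G that by (simp_all add: is_functor_def)
  have Gc [simp]: "Gm (Comp D n m) = Comp C (Gm n) (Gm m)"
    if "n \<in> Arr D" "m \<in> Arr D" "Dom D n = Cod D m" for n m
    using G that by (simp add: is_functor_def)
  note [simp] = C.dom_obj C.cod_obj C.ident_arr C.dom_ident C.cod_ident C.comp_arr C.dom_comp
    C.cod_comp C.comp_ident_right C.comp_ident_left D.dom_obj D.cod_obj D.ident_arr D.dom_ident
    D.cod_ident D.comp_arr D.dom_comp D.cod_comp D.comp_ident_right D.comp_ident_left
  have "\<forall>x \<in> Obj C. \<exists>a h k. a \<in> Obj D \<and> h \<in> Arr C \<and> k \<in> Arr C \<and> Dom C h = x \<and> Cod C h = Go a \<and>
      Dom C k = Go a \<and> Cod C k = x \<and> Comp C k h = Ident C x \<and> Comp C h k = Ident C (Go a)"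
    using ess_surj unfolding is_iso_def by fastforce
  then obtain Fo h k where "\<forall>x \<in> Obj C. Fo x \<in> Obj D \<and> h x \<in> Arr C \<and> k x \<in> Arr C \<and>
      Dom C (h x) = x \<and> Cod C (h x) = Go (Fo x) \<and> Dom C (k x) = Go (Fo x) \<and> Cod C (k x) = x \<and>
      Comp C (k x) (h x) = Ident C x \<and> Comp C (h x) (k x) = Ident C (Go (Fo x))"
    unfolding bchoice_iff by blast
  then have Fo [simp]: "\<And>x. x \<in> Obj C \<Longrightarrow> Fo x \<in> Obj D"
    and h [simp]: "\<And>x. x \<in> Obj C \<Longrightarrow> h x \<in> Arr C" "\<And>x. x \<in> Obj C \<Longrightarrow> Dom C (h x) = x"
      "\<And>x. x \<in> Obj C \<Longrightarrow> Cod C (h x) = Go (Fo x)"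
    and k [simp]: "\<And>x. x \<in> Obj C \<Longrightarrow> k x \<in> Arr C" "\<And>x. x \<in> Obj C \<Longrightarrow> Dom C (k x) = Go (Fo x)"
      "\<And>x. x \<in> Obj C \<Longrightarrow> Cod C (k x) = x"
    and kh: "\<And>x. x \<in> Obj C \<Longrightarrow> Comp C (k x) (h x) = Ident C x"
    and hk: "\<And>x. x \<in> Obj C \<Longrightarrow> Comp C (h x) (k x) = Ident C (Go (Fo x))"
    by blast+
  \<comment> \<open>Transport along the chosen isomorphisms lands in the image of \<open>G\<close>, and is lifted there.\<close>
  define conj where "conj f = Comp C (h (Cod C f)) (Comp C f (k (Dom C f)))" for f
  have conj [simp]: "conj f \<in> Arr C" "Dom C (conj f) = Go (Fo (Dom C f))"
    "Cod C (conj f) = Go (Fo (Cod C f))" if "f \<in> Arr C" for f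
    using that by (simp_all add: conj_def)
  have conj_h: "Comp C (conj f) (h (Dom C f)) = Comp C (h (Cod C f)) f" if "f \<in> Arr C" for f
    using that by (simp add: conj_def C.comp_assoc kh)
  have k_conj: "Comp C (k (Cod C f)) (conj f) = Comp C f (k (Dom C f))" if "f \<in> Arr C" for f
    using that by (simp add: conj_def C.comp_assoc[symmetric] kh)
  have conj_comp: "conj (Comp C g f) = Comp C (conj g) (conj f)"
    if g: "g \<in> Arr C" and f: "f \<in> Arr C" and gf: "Dom C g = Cod C f" for g f
  proof -
    have "Comp C (conj g) (conj f)
        = Comp C (Comp C (conj g) (h (Dom C g))) (Comp C f (k (Dom C f)))"
      using that by (simp add: conj_def[of f] C.comp_assoc)
    also have "\<dots> = conj (Comp C g f)"
      unfolding conj_h[OF g] using that by (simp add: conj_def C.comp_assoc)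
    finally show ?thesis by simp
  qed
  have "\<forall>f \<in> Arr C. \<exists>m. m \<in> Arr D \<and> Dom D m = Fo (Dom C f) \<and> Cod D m = Fo (Cod C f) \<and> Gm m = conj f"
    using full[OF Fo Fo conj(1) conj(2) conj(3)] by auto
  then obtain Fm where "\<forall>f \<in> Arr C. Fm f \<in> Arr D \<and> Dom D (Fm f) = Fo (Dom C f) \<and>
      Cod D (Fm f) = Fo (Cod C f) \<and> Gm (Fm f) = conj f"
    unfolding bchoice_iff by blast
  then have Fm [simp]: "\<And>f. f \<in> Arr C \<Longrightarrow> Fm f \<in> Arr D"
      "\<And>f. f \<in> Arr C \<Longrightarrow> Dom D (Fm f) = Fo (Dom C f)" "\<And>f. f \<in> Arr C \<Longrightarrow> Cod D (Fm f) = Fo (Cod C f)"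
      "\<And>f. f \<in> Arr C \<Longrightarrow> Gm (Fm f) = conj f"
    by blast+
  have F: "is_functor C D Fo Fm"
    unfolding is_functor_def
  proof (intro conjI ballI impI)
    fix x assume x: "x \<in> Obj C"
    have "conj (Ident C x) = Ident C (Go (Fo x))"
      using x C.comp_ident_left[of "k x"] by (simp add: conj_def hk)
    then show "Fm (Ident C x) = Ident D (Fo x)"
      by (intro faithful) (use x in simp_all)
  next
    fix g f assume "g \<in> Arr C" "f \<in> Arr C" "Dom C g = Cod C f"
    then show "Fm (Comp C g f) = Comp D (Fm g) (Fm f)"
      by (intro faithful) (simp_all add: conj_comp)
  qed simp_all
  have eta: "natural_iso C C id id (Go \<circ> Fo) (Gm \<circ> Fm) h"
    unfolding natural_iso_def is_iso_def
  proof (intro conjI ballI)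
    fix x assume x: "x \<in> Obj C"
    show "\<exists>g\<in>Arr C. Dom C g = Cod C (h x) \<and> Cod C g = Dom C (h x) \<and>
        Comp C g (h x) = Ident C (Dom C (h x)) \<and> Comp C (h x) g = Ident C (Cod C (h x))"
      by (rule bexI[of _ "k x"]) (use x in \<open>simp_all add: kh hk\<close>)
  qed (simp_all add: conj_h)
  have "\<forall>a \<in> Obj D. \<exists>e. is_iso D e \<and> Dom D e = Fo (Go a) \<and> Cod D e = a \<and> Gm e = k (Go a)"
  proof
    fix a assume a: "a \<in> Obj D"
    obtain e where e: "e \<in> Arr D" "Dom D e = Fo (Go a)" "Cod D e = a" "Gm e = k (Go a)"
      using full[of "Fo (Go a)" a "k (Go a)"] a by auto
    obtain e' where e': "e' \<in> Arr D" "Cod D e' = Fo (Go a)" "Dom D e' = a" "Gm e' = h (Go a)"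
      using full[of a "Fo (Go a)" "h (Go a)"] a by auto
    have "Comp D e' e = Ident D (Fo (Go a))"
      by (rule faithful) (use a e e' in \<open>simp_all add: hk\<close>)
    moreover have "Comp D e e' = Ident D a"
      by (rule faithful) (use a e e' in \<open>simp_all add: kh\<close>)
    ultimately have "is_iso D e" unfolding is_iso_def using e e' by auto
    then show "\<exists>e. is_iso D e \<and> Dom D e = Fo (Go a) \<and> Cod D e = a \<and> Gm e = k (Go a)"
      using e by blast
  qed
  then obtain \<epsilon> where "\<forall>a \<in> Obj D. is_iso D (\<epsilon> a) \<and> Dom D (\<epsilon> a) = Fo (Go a) \<and> Cod D (\<epsilon> a) = a \<and>
      Gm (\<epsilon> a) = k (Go a)"
    unfolding bchoice_iff by blast
  then have eps: "\<And>a. a \<in> Obj D \<Longrightarrow> is_iso D (\<epsilon> a)"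
      "\<And>a. a \<in> Obj D \<Longrightarrow> Dom D (\<epsilon> a) = Fo (Go a)" "\<And>a. a \<in> Obj D \<Longrightarrow> Cod D (\<epsilon> a) = a"
      "\<And>a. a \<in> Obj D \<Longrightarrow> Gm (\<epsilon> a) = k (Go a)"
    by blast+
  have [simp]: "\<epsilon> a \<in> Arr D" if "a \<in> Obj D" for a using eps(1)[OF that] by (simp add: is_iso_def)
  have epsilon: "natural_iso D D (Fo \<circ> Go) (Fm \<circ> Gm) id id \<epsilon>"
    unfolding natural_iso_def
  proof (intro conjI ballI)
    fix m assume m: "m \<in> Arr D"
    have "Comp D m (\<epsilon> (Dom D m)) = Comp D (\<epsilon> (Cod D m)) (Fm (Gm m))"
      by (rule faithful) (use m k_conj[of "Gm m"] in \<open>simp_all add: eps\<close>)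
    then show "Comp D (id m) (\<epsilon> (Dom D m)) = Comp D (\<epsilon> (Cod D m)) ((Fm \<circ> Gm) m)" by simp
  qed (use eps in auto)
  show ?thesis
    unfolding equivalent_cats_def by (intro conjI exI) (rule C D F G eta epsilon)+
qed

section \<open>Inverses in an inverse semigroup\<close>

context inverse_semigroup
begin

definition star :: "'a \<Rightarrow> 'a" where
  "star x = (THE y. y \<in> carrier S \<and> x \<cdot> y \<cdot> x = x \<and> y \<cdot> x \<cdot> y = y)"

lemma star_props:
  assumes "x \<in> carrier S"
  shows star_closed: "star x \<in> carrier S"
    and mult_star_mult: "x \<cdot> star x \<cdot> x = x"
    and star_mult_star: "star x \<cdot> x \<cdot> star x = star x"
  using theI'[OF unique_inverse[OF assms]] by (auto simp: star_def)

lemma star_unique: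
  assumes "x \<in> carrier S" "y \<in> carrier S" "x \<cdot> y \<cdot> x = x" "y \<cdot> x \<cdot> y = y"
  shows "star x = y"
  by (rule inverse_eq[of x]) (use assms star_props[OF assms(1)] in simp_all)

text \<open>The laws of the inverse in the shape in which they rewrite products that are associated to the
  right.\<close>

lemma star_reassoc:
  assumes [simp]: "x \<in> carrier S"
  shows "x \<cdot> (star x \<cdot> x) = x" "star x \<cdot> (x \<cdot> star x) = star x"
    and "z \<in> carrier S \<Longrightarrow> x \<cdot> (star x \<cdot> (x \<cdot> z)) = x \<cdot> z"
    and "z \<in> carrier S \<Longrightarrow> star x \<cdot> (x \<cdot> (star x \<cdot> z)) = star x \<cdot> z"
  using star_props[of x] by (simp_all add: mult_assoc[symmetric] mult_closed)

lemma star_star: "x \<in> carrier S \<Longrightarrow> star (star x) = x"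
  by (rule star_unique) (simp_all add: star_props)

lemma star_idem: "e \<in> idempotents S \<Longrightarrow> star e = e"
  by (rule star_unique) (simp_all add: idemD)

lemma star_mult_idem: "x \<in> carrier S \<Longrightarrow> star x \<cdot> x \<in> idempotents S"
  and mult_star_idem: "x \<in> carrier S \<Longrightarrow> x \<cdot> star x \<in> idempotents S"
  by (simp_all add: idempotents_def mult_closed star_closed mult_assoc star_reassoc)

text \<open>The expected inverse works because the idempotents \<open>x\<^sup>* x\<close> and \<open>y y\<^sup>*\<close> in the middle commute.\<close>

lemma star_mult:
  assumes x: "x \<in> carrier S" and y: "y \<in> carrier S"
  shows "star (x \<cdot> y) = star y \<cdot> star x"
proof -
  note [simp] = mult_closed star_closed
  define p q where "p = star x \<cdot> x" "q = y \<cdot> star y"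
  have pq: "p \<in> idempotents S" "q \<in> idempotents S"
    using x y by (simp_all add: p_q_def star_mult_idem mult_star_idem)
  note [simp] = idemD(1)[OF pq(1)] idemD(1)[OF pq(2)]
  have *: "x \<cdot> p = x" "q \<cdot> y = y" "p \<cdot> star x = star x" "star y \<cdot> q = star y"
    using x y star_props by (simp_all add: p_q_def mult_assoc[symmetric])
  have "x \<cdot> y \<cdot> (star y \<cdot> star x) \<cdot> (x \<cdot> y) = x \<cdot> (q \<cdot> p) \<cdot> y"
    using x y by (simp add: p_q_def mult_assoc)
  also have "\<dots> = (x \<cdot> p) \<cdot> (q \<cdot> y)"
    unfolding idem_commute[OF pq(2,1)] using x y by (simp add: mult_assoc)
  finally have 1: "x \<cdot> y \<cdot> (star y \<cdot> star x) \<cdot> (x \<cdot> y) = x \<cdot> y" by (simp add: *)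
  have "star y \<cdot> star x \<cdot> (x \<cdot> y) \<cdot> (star y \<cdot> star x) = star y \<cdot> (p \<cdot> q) \<cdot> star x"
    using x y by (simp add: p_q_def mult_assoc)
  also have "\<dots> = (star y \<cdot> q) \<cdot> (p \<cdot> star x)"
    unfolding idem_commute[OF pq] using x y by (simp add: mult_assoc)
  finally have 2: "star y \<cdot> star x \<cdot> (x \<cdot> y) \<cdot> (star y \<cdot> star x) = star y \<cdot> star x" by (simp add: *)
  show ?thesis using x y 1 2 by (intro star_unique) simp_all
qed

lemma greenL_star:
  assumes "(s, t) \<in> greenL S" shows "star s \<cdot> s = star t \<cdot> t"
proof -
  have *: "star t \<cdot> t \<cdot> (star s \<cdot> s) = star t \<cdot> t"
    if st: "s \<in> carrier S" "x \<in> carrier S" "t = x \<cdot> s" for s t x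
  proof -
    have "t \<cdot> (star s \<cdot> s) = t"
      using st mult_star_mult[OF st(1)] by (simp add: mult_assoc mult_closed star_closed)
    then show ?thesis using st by (simp add: mult_assoc mult_closed star_closed)
  qed
  obtain x y where xy: "s \<in> carrier S" "t \<in> carrier S" "x \<in> carrier S" "y \<in> carrier S"
      "t = x \<cdot> s" "s = y \<cdot> t"
    using assms unfolding greenL_iff by blast
  show ?thesis
    using *[OF xy(1,3,5)] *[OF xy(2,4,6)]
      idem_commute[OF star_mult_idem[OF xy(1)] star_mult_idem[OF xy(2)]] by simp
qed

lemma greenR_star:
  assumes "(s, t) \<in> greenR S" shows "s \<cdot> star s = t \<cdot> star t"
proof -
  have *: "(s \<cdot> star s) \<cdot> (t \<cdot> star t) = t \<cdot> star t"
    if st: "s \<in> carrier S" "x \<in> carrier S" "t = s \<cdot> x" for s t x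
  proof -
    have "s \<cdot> star s \<cdot> t = t"
      using st mult_star_mult[OF st(1)] by (simp add: mult_assoc[symmetric] mult_closed star_closed)
    then show ?thesis using st by (simp add: mult_assoc[symmetric] mult_closed star_closed)
  qed
  obtain x y where xy: "s \<in> carrier S" "t \<in> carrier S" "x \<in> carrier S" "y \<in> carrier S"
      "t = s \<cdot> x" "s = t \<cdot> y"
    using assms unfolding greenR_iff by blast
  show ?thesis
    using *[OF xy(1,3,5)] *[OF xy(2,4,6)]
      idem_commute[OF mult_star_idem[OF xy(1)] mult_star_idem[OF xy(2)]] by simp
qed

lemma greenL_iff_star:
  assumes "s \<in> carrier S" "t \<in> carrier S"
  shows "(s, t) \<in> greenL S \<longleftrightarrow> star s \<cdot> s = star t \<cdot> t"
proof
  assume "star s \<cdot> s = star t \<cdot> t"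
  then have "t = (t \<cdot> star s) \<cdot> s" "s = (s \<cdot> star t) \<cdot> t"
    using assms mult_star_mult by (metis mult_assoc star_closed)+
  then show "(s, t) \<in> greenL S"
    unfolding greenL_iff using assms mult_closed star_closed by blast
qed (rule greenL_star)

lemma greenR_iff_star:
  assumes "s \<in> carrier S" "t \<in> carrier S"
  shows "(s, t) \<in> greenR S \<longleftrightarrow> s \<cdot> star s = t \<cdot> star t"
proof
  assume "s \<cdot> star s = t \<cdot> star t"
  then have "t = s \<cdot> (star s \<cdot> t)" "s = t \<cdot> (star t \<cdot> s)"
    using assms mult_star_mult by (metis mult_assoc star_closed)+
  then show "(s, t) \<in> greenR S"
    unfolding greenR_iff using assms mult_closed star_closed by blast
qed (rule greenR_star)

lemma combinatorial_eqI:
  assumes "combinatorial S" "s \<in> carrier S" "t \<in> carrier S"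
    and "star s \<cdot> s = star t \<cdot> t" "s \<cdot> star s = t \<cdot> star t"
  shows "s = t"
  using assms by (auto simp: combinatorial_def greenH_def greenL_iff_star greenR_iff_star)

text \<open>\<open>\<D>\<close>-related idempotents are thus those that are isomorphic as objects of the idempotent splitting,
  with \<open>t\<close> as the isomorphism.\<close>

lemma greenD_idem_iff:
  assumes e: "e \<in> idempotents S" and f: "f \<in> idempotents S"
  shows "(e, f) \<in> greenD S \<longleftrightarrow> (\<exists>t \<in> carrier S. star t \<cdot> t = e \<and> t \<cdot> star t = f)"
proof -
  have L: "(e, t) \<in> greenL S \<longleftrightarrow> star t \<cdot> t = e" if "t \<in> carrier S" for t
    using that e by (auto simp: greenL_iff_star star_idem idemD)
  have R: "(t, f) \<in> greenR S \<longleftrightarrow> t \<cdot> star t = f" if "t \<in> carrier S" for t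
    using that f by (auto simp: greenR_iff_star star_idem idemD)
  have "t \<in> carrier S" if "(e, t) \<in> greenL S" for t using that unfolding greenL_iff by blast
  then show ?thesis unfolding greenD_def relcomp_unfold using L R by blast
qed

lemma arr_idem_splitting_iff:
  "(e, s, f) \<in> Arr (idem_splitting S) \<longleftrightarrow> e \<in> idempotents S \<and> f \<in> idempotents S \<and>
     s \<in> carrier S \<and> e \<cdot> s = s \<and> s \<cdot> f = s"
proof -
  have "e \<cdot> (e \<cdot> x \<cdot> f) = e \<cdot> x \<cdot> f \<and> e \<cdot> x \<cdot> f \<cdot> f = e \<cdot> x \<cdot> f"
    if "e \<in> idempotents S" "f \<in> idempotents S" "x \<in> carrier S" for x
  proof -
    note c = idemD(1)[OF that(1)] idemD(1)[OF that(2)] that(3)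
    have "e \<cdot> (e \<cdot> x) = e \<cdot> x"
      by (simp only: mult_assoc[OF c(1,1,3), symmetric] idemD(2)[OF that(1)])
    then have "e \<cdot> (e \<cdot> x \<cdot> f) = e \<cdot> x \<cdot> f"
      by (simp only: mult_assoc[OF c(1) mult_closed[OF c(1,3)] c(2), symmetric])
    then show ?thesis
      by (simp only: mult_assoc[OF mult_closed[OF c(1,3)] c(2,2)] idemD(2)[OF that(2)])
  qed
  moreover have "\<exists>x. s = e \<cdot> x \<cdot> f \<and> x \<in> carrier S" if "e \<cdot> s = s" "s \<cdot> f = s" "s \<in> carrier S"
    using that by (intro exI[of _ s]) simp
  ultimately show ?thesis
    unfolding idem_splitting_def by (auto simp: idemD mult_closed)
qed

section \<open>Conjugation and chains of covers\<close>

lemma idem_le_trans: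
  assumes "a \<in> carrier S" "b \<in> carrier S" "c \<in> carrier S" "a \<cdot> b = a" "b \<cdot> c = b"
  shows "a \<cdot> c = a"
  using assms by (metis mult_assoc)

text \<open>Conjugation by \<open>t\<close> is an order isomorphism from the idempotents below \<open>t t\<^sup>*\<close> onto those below
  \<open>t\<^sup>* t\<close>, with inverse the conjugation by \<open>t\<^sup>*\<close>. So it transports chains of covers.\<close>

definition conjugate :: "'a \<Rightarrow> 'a \<Rightarrow> 'a" where "conjugate t x = star t \<cdot> x \<cdot> t"

lemma conjugate_closed: "\<lbrakk>t \<in> carrier S; x \<in> carrier S\<rbrakk> \<Longrightarrow> conjugate t x \<in> carrier S"
  by (simp add: conjugate_def mult_closed star_closed)

lemma conjugate_mult:
  assumes t: "t \<in> carrier S" and x: "x \<in> idempotents S" and y: "y \<in> idempotents S"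
  shows "conjugate t (x \<cdot> y) = conjugate t x \<cdot> conjugate t y"
proof -
  note c [simp] = t star_closed[OF t] idemD(1)[OF x] idemD(1)[OF y] mult_closed
  have "conjugate t x \<cdot> conjugate t y = star t \<cdot> x \<cdot> ((t \<cdot> star t) \<cdot> y) \<cdot> t"
    by (simp add: conjugate_def mult_assoc)
  also have "\<dots> = star t \<cdot> x \<cdot> (y \<cdot> (t \<cdot> star t)) \<cdot> t"
    using idem_commute[OF mult_star_idem[OF t] y] by simp
  also have "\<dots> = conjugate t (x \<cdot> y)"
    by (simp add: conjugate_def mult_assoc star_reassoc)
  finally show ?thesis by simp
qed

lemma conjugate_idem:
  assumes "t \<in> carrier S" "x \<in> idempotents S" shows "conjugate t x \<in> idempotents S"
  using conjugate_mult[OF assms assms(2), unfolded idemD(2)[OF assms(2)], symmetric]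
  by (simp add: idempotents_def conjugate_closed[OF assms(1) idemD(1)[OF assms(2)]])

lemma conjugate_conjugate:
  assumes t: "t \<in> carrier S" and x: "x \<in> idempotents S" and le: "x \<cdot> (t \<cdot> star t) = x"
  shows "conjugate (star t) (conjugate t x) = x"
proof -
  note c [simp] = t star_closed[OF t] idemD(1)[OF x] mult_closed
  have "conjugate (star t) (conjugate t x) = (t \<cdot> star t) \<cdot> x \<cdot> (t \<cdot> star t)"
    by (simp add: conjugate_def star_star mult_assoc)
  also have "\<dots> = x"
    using idem_commute[OF mult_star_idem[OF t] x] le by simp
  finally show ?thesis .
qed

lemma conjugate_le:
  assumes "t \<in> carrier S" "x \<in> carrier S" shows "conjugate t x \<cdot> (star t \<cdot> t) = conjugate t x"
  using assms by (simp add: conjugate_def mult_assoc mult_closed star_closed star_reassoc)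

lemma covered_by_iff:
  "covered_by S f e \<longleftrightarrow> f \<in> idempotents S \<and> e \<in> idempotents S \<and> f \<cdot> e = f \<and> f \<noteq> e \<and>
     (\<forall>g \<in> idempotents S. f \<cdot> g = f \<longrightarrow> g \<cdot> e = g \<longrightarrow> g = f \<or> g = e)"
  unfolding covered_by_def nat_less_def by (auto simp: nat_le_idem_iff)

lemma covered_by_conjugate:
  assumes t: "t \<in> carrier S" and xy: "covered_by S x y" and y: "y \<cdot> (t \<cdot> star t) = y"
  shows "covered_by S (conjugate t x) (conjugate t y)"
proof -
  have i: "x \<in> idempotents S" "y \<in> idempotents S" and xy': "x \<cdot> y = x" "x \<noteq> y"
    and min: "\<And>g. \<lbrakk>g \<in> idempotents S; x \<cdot> g = x; g \<cdot> y = g\<rbrakk> \<Longrightarrow> g = x \<or> g = y"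
    using xy by (auto simp: covered_by_iff)
  note t' = star_closed[OF t]
  note ci = conjugate_idem[OF t i(1)] conjugate_idem[OF t i(2)]
  have x: "x \<cdot> (t \<cdot> star t) = x"
    using idem_le_trans[OF _ _ _ xy'(1) y] i[THEN idemD(1)] t t' by (simp add: mult_closed)
  note conj_back = conjugate_conjugate[OF t i(1) x] conjugate_conjugate[OF t i(2) y]
  have "conjugate t x \<cdot> conjugate t y = conjugate t x"
    by (rule conjugate_mult[OF t i, unfolded xy'(1), symmetric])
  moreover have "conjugate t x \<noteq> conjugate t y" using conj_back xy'(2) by auto
  moreover have "g = conjugate t x \<or> g = conjugate t y"
    if g: "g \<in> idempotents S" "conjugate t x \<cdot> g = conjugate t x" "g \<cdot> conjugate t y = g" for g
  proof -
    let ?g = "conjugate (star t) g"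
    have "x \<cdot> ?g = x" by (rule conjugate_mult[OF t' ci(1) g(1), unfolded g(2) conj_back, symmetric])
    moreover have "?g \<cdot> y = ?g" by (rule conjugate_mult[OF t' g(1) ci(2), unfolded g(3) conj_back, symmetric])
    ultimately have "?g = x \<or> ?g = y" using min conjugate_idem[OF t' g(1)] by blast
    moreover have "g \<cdot> (star t \<cdot> t) = g"
      using idem_le_trans[OF _ _ _ g(3) conjugate_le[OF t idemD(1)[OF i(2)]]] g(1) ci t t'
      by (simp add: idemD mult_closed)
    then have "conjugate t ?g = g"
      using conjugate_conjugate[OF t' g(1)] t by (simp add: star_star)
    ultimately show ?thesis by auto
  qed
  ultimately show ?thesis using ci by (auto simp: covered_by_iff)
qed

lemma relpow_covered_le:
  assumes "(covered_by S ^^ n) x y" "x \<in> idempotents S" shows "x \<cdot> y = x"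
  using assms(1)
proof (induction n arbitrary: y)
  case 0
  then show ?case using assms(2) by (simp add: idemD)
next
  case (Suc n)
  then obtain z where z: "x \<cdot> z = x" "covered_by S z y" by auto
  then have "z \<in> carrier S" "y \<in> carrier S" "z \<cdot> y = z" by (auto simp: covered_by_iff idemD)
  then show ?case using z(1) idemD(1)[OF assms(2)] by (metis idem_le_trans)
qed

lemma relpow_covered_conjugate:
  assumes t: "t \<in> carrier S" and "(covered_by S ^^ n) x y" and "y \<cdot> (t \<cdot> star t) = y"
  shows "(covered_by S ^^ n) (conjugate t x) (conjugate t y)"
  using assms(2,3)
proof (induction n arbitrary: y)
  case (Suc n)
  then obtain z where z: "(covered_by S ^^ n) x z" "covered_by S z y" by auto
  then have i: "z \<in> carrier S" "y \<in> carrier S" "z \<cdot> y = z" by (auto simp: covered_by_iff idemD)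
  have "z \<cdot> (t \<cdot> star t) = z"
    using idem_le_trans[OF i(1,2) _ i(3) Suc.prems(2)] t by (simp add: mult_closed star_closed)
  then have "(covered_by S ^^ n) (conjugate t x) (conjugate t z)" using Suc.IH z(1) by blast
  then show ?case using covered_by_conjugate[OF t z(2) Suc.prems(2)] by auto
qed simp

end

section \<open>Morita equivalence from an embedding\<close>

text \<open>The axioms of an inverse semigroup are pulled back along the injection \<open>\<phi>\<close>. On idempotent
  splittings \<open>\<phi>\<close> acts componentwise: injectivity makes the functor faithful, the condition on corners
  makes it full, and essential surjectivity is the condition on \<open>\<D>\<close>-classes.\<close>

lemma morita_equivalent_of_embedding:
  fixes S :: "('a, 'b) semigroup0_scheme" and T :: "('c, 'd) semigroup0_scheme"
  assumes S: "inverse_semigroup S"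
    and T_closed: "\<And>x y. \<lbrakk>x \<in> carrier T; y \<in> carrier T\<rbrakk> \<Longrightarrow> x \<cdot>\<^bsub>T\<^esub> y \<in> carrier T"
    and \<phi>_closed: "\<And>x. x \<in> carrier T \<Longrightarrow> \<phi> x \<in> carrier S"
    and \<phi>_mult: "\<And>x y. \<lbrakk>x \<in> carrier T; y \<in> carrier T\<rbrakk> \<Longrightarrow> \<phi> (x \<cdot>\<^bsub>T\<^esub> y) = \<phi> x \<cdot>\<^bsub>S\<^esub> \<phi> y"
    and \<phi>_inj: "inj_on \<phi> (carrier T)"
    and \<phi>_star: "\<And>x. x \<in> carrier T \<Longrightarrow> inverse_semigroup.star S (\<phi> x) \<in> \<phi> ` carrier T"
    and full: "\<And>a b s. \<lbrakk>a \<in> idempotents T; b \<in> idempotents T; s \<in> carrier S;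
                  \<phi> a \<cdot>\<^bsub>S\<^esub> s = s; s \<cdot>\<^bsub>S\<^esub> \<phi> b = s\<rbrakk> \<Longrightarrow> s \<in> \<phi> ` carrier T"
    and dense: "\<And>g. g \<in> idempotents S \<Longrightarrow> \<exists>a \<in> idempotents T. (g, \<phi> a) \<in> greenD S"
  shows "morita_equivalent S T"
proof -
  interpret S: inverse_semigroup S by (rule S)
  note injD = inj_onD[OF \<phi>_inj]
  interpret T: inverse_semigroup T
  proof
    fix x y z assume "x \<in> carrier T" "y \<in> carrier T" "z \<in> carrier T"
    then show "x \<cdot>\<^bsub>T\<^esub> y \<cdot>\<^bsub>T\<^esub> z = x \<cdot>\<^bsub>T\<^esub> (y \<cdot>\<^bsub>T\<^esub> z)"
      by (intro injD) (simp_all add: \<phi>_mult T_closed \<phi>_closed S.mult_assoc)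
  next
    fix x assume x: "x \<in> carrier T"
    obtain y where y: "y \<in> carrier T" "\<phi> y = S.star (\<phi> x)" using \<phi>_star[OF x] by force
    show "\<exists>!y. y \<in> carrier T \<and> x \<cdot>\<^bsub>T\<^esub> y \<cdot>\<^bsub>T\<^esub> x = x \<and> y \<cdot>\<^bsub>T\<^esub> x \<cdot>\<^bsub>T\<^esub> y = y"
    proof (rule ex1I[of _ y])
      have "\<phi> (x \<cdot>\<^bsub>T\<^esub> y \<cdot>\<^bsub>T\<^esub> x) = \<phi> x" "\<phi> (y \<cdot>\<^bsub>T\<^esub> x \<cdot>\<^bsub>T\<^esub> y) = \<phi> y"
        using x y S.star_props[OF \<phi>_closed[OF x]] by (simp_all add: \<phi>_mult T_closed)
      then show "y \<in> carrier T \<and> x \<cdot>\<^bsub>T\<^esub> y \<cdot>\<^bsub>T\<^esub> x = x \<and> y \<cdot>\<^bsub>T\<^esub> x \<cdot>\<^bsub>T\<^esub> y = y"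
        using x y(1) by (auto intro!: injD T_closed)
    next
      fix z assume z: "z \<in> carrier T \<and> x \<cdot>\<^bsub>T\<^esub> z \<cdot>\<^bsub>T\<^esub> x = x \<and> z \<cdot>\<^bsub>T\<^esub> x \<cdot>\<^bsub>T\<^esub> z = z"
      then have "\<phi> x \<cdot>\<^bsub>S\<^esub> \<phi> z \<cdot>\<^bsub>S\<^esub> \<phi> x = \<phi> x" "\<phi> z \<cdot>\<^bsub>S\<^esub> \<phi> x \<cdot>\<^bsub>S\<^esub> \<phi> z = \<phi> z"
        using x by (metis \<phi>_mult T_closed)+
      then have "S.star (\<phi> x) = \<phi> z" using x z by (intro S.star_unique \<phi>_closed) auto
      then show "z = y" using y z by (intro injD) auto
    qed
  qed (rule T_closed)
  have \<phi>_idem: "\<phi> a \<in> idempotents S" if "a \<in> idempotents T" for a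
    using that by (auto simp: idempotents_def \<phi>_closed \<phi>_mult[symmetric])
  let ?C = "idem_splitting S" and ?D = "idem_splitting T"
  let ?m = "\<lambda>(a, s, b). (\<phi> a, \<phi> s, \<phi> b)"
  have arrT: "s \<in> carrier T" "\<phi> a \<cdot>\<^bsub>S\<^esub> \<phi> s = \<phi> s" "\<phi> s \<cdot>\<^bsub>S\<^esub> \<phi> b = \<phi> s"
      "a \<in> idempotents T" "b \<in> idempotents T" if "(a, s, b) \<in> Arr ?D" for a s b
    using that T.idemD by (auto simp: T.arr_idem_splitting_iff \<phi>_mult[symmetric])
  have "equivalent_cats ?C ?D"
  proof (rule equivalent_cats_of_fully_faithful)
    show "is_functor ?D ?C \<phi> ?m"
      unfolding is_functor_def
    proof (intro conjI ballI impI)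
      fix g f assume gf: "g \<in> Arr ?D" "f \<in> Arr ?D" "Dom ?D g = Cod ?D f"
      obtain a s b b' t c where *: "g = (a, s, b)" "f = (b', t, c)"
        by (metis prod_cases3)
      have "s \<in> carrier T" "t \<in> carrier T" using gf(1,2) unfolding * by (auto dest: arrT(1))
      then show "?m (Comp ?D g f) = Comp ?C (?m g) (?m f)"
        unfolding * by (simp add: idem_splitting_def \<phi>_mult)
    next
      fix f assume f: "f \<in> Arr ?D"
      obtain a s b where *: "f = (a, s, b)" by (metis prod_cases3)
      show "?m f \<in> Arr ?C"
        using arrT[OF f[unfolded *]] unfolding *
        by (simp add: S.arr_idem_splitting_iff \<phi>_idem \<phi>_closed)
      show "Dom ?C (?m f) = \<phi> (Dom ?D f)" "Cod ?C (?m f) = \<phi> (Cod ?D f)"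
        by (cases f, simp add: idem_splitting_def)+
    qed (simp_all add: idem_splitting_def \<phi>_idem)
  next
    fix m m' assume m: "m \<in> Arr ?D" "m' \<in> Arr ?D" "Dom ?D m = Dom ?D m'" "Cod ?D m = Cod ?D m'"
      "?m m = ?m m'"
    obtain a s b a' t b' where *: "m = (a, s, b)" "m' = (a', t, b')"
      by (metis prod_cases3)
    have "s \<in> carrier T" "t \<in> carrier T" using m(1,2) unfolding * by (auto dest: arrT(1))
    then have "s = t" using m(5) injD unfolding * by simp
    then show "m = m'" using m(3,4) unfolding * by (simp add: idem_splitting_def)
  next
    fix a b f assume ab: "a \<in> Obj ?D" "b \<in> Obj ?D" and f: "f \<in> Arr ?C" "Dom ?C f = \<phi> a" "Cod ?C f = \<phi> b"
    have ab': "a \<in> idempotents T" "b \<in> idempotents T" using ab by (simp_all add: idem_splitting_def)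
    obtain s where s: "f = (\<phi> b, s, \<phi> a)" using f(2,3) by (cases f) (simp add: idem_splitting_def)
    have s': "s \<in> carrier S" "\<phi> b \<cdot>\<^bsub>S\<^esub> s = s" "s \<cdot>\<^bsub>S\<^esub> \<phi> a = s"
      using f(1) unfolding s S.arr_idem_splitting_iff by auto
    obtain x where x: "x \<in> carrier T" "s = \<phi> x" using full[OF ab'(2,1) s'] by blast
    have "b \<cdot>\<^bsub>T\<^esub> x = x" "x \<cdot>\<^bsub>T\<^esub> a = x"
      using s' x ab'[THEN T.idemD(1)] by (auto intro!: injD simp: \<phi>_mult T_closed)
    then have "(b, x, a) \<in> Arr ?D" using ab' x by (simp add: T.arr_idem_splitting_iff)
    then show "\<exists>m \<in> Arr ?D. Dom ?D m = a \<and> Cod ?D m = b \<and> ?m m = f"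
      using x s by (intro bexI[of _ "(b, x, a)"]) (simp_all add: idem_splitting_def)
  next
    fix g assume "g \<in> Obj ?C"
    then have g: "g \<in> idempotents S" by (simp add: idem_splitting_def)
    obtain a where a: "a \<in> idempotents T" "(g, \<phi> a) \<in> greenD S" using dense[OF g] by blast
    obtain t where t: "t \<in> carrier S" "S.star t \<cdot>\<^bsub>S\<^esub> t = g" "t \<cdot>\<^bsub>S\<^esub> S.star t = \<phi> a"
      using a S.greenD_idem_iff[OF g \<phi>_idem] by blast
    have arr: "(\<phi> a, t, g) \<in> Arr ?C" "(g, S.star t, \<phi> a) \<in> Arr ?C"
      unfolding S.arr_idem_splitting_iff t(2,3)[symmetric]
      using t(1) S.star_mult_idem S.mult_star_idem
      by (simp_all add: S.star_closed S.mult_closed S.mult_assoc S.star_reassoc)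
    have "is_iso ?C (\<phi> a, t, g)"
      unfolding is_iso_def
      by (intro conjI arr bexI[of _ "(g, S.star t, \<phi> a)"]) (simp_all add: idem_splitting_def t)
    then show "\<exists>a \<in> Obj ?D. \<exists>f. is_iso ?C f \<and> Dom ?C f = g \<and> Cod ?C f = \<phi> a"
      using a(1) by (intro bexI[of _ a] exI[of _ "(\<phi> a, t, g)"]) (simp_all add: idem_splitting_def)
  qed (rule S.cat_idem_splitting T.cat_idem_splitting)+
  then show ?thesis
    unfolding morita_equivalent_def
    using S.inverse_semigroup_axioms T.inverse_semigroup_axioms by blast
qed

section \<open>Coherent sets of representatives\<close>

locale coherent_semigroup = inverse_semigroup0 S for S :: "('a, 'b) semigroup0_scheme" (structure) +
  fixes C :: "'a set"
  assumes combinatorial: "combinatorial S"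
    and finite_intervals: "finite_intervals S"
    and coh: "coherent S C"
begin

abbreviation nzC :: "'a set" where "nzC \<equiv> C - {\<zero>\<^sub>s}"

definition repr :: "'a \<Rightarrow> 'a" where "repr f = rep C (Dclass S f)"

abbreviation covers :: "'a \<Rightarrow> 'a \<Rightarrow> bool" (infix \<open>\<lless>\<close> 50) where
  "f \<lless> e \<equiv> covered_by S f e"

lemma zero_idem: "\<zero>\<^sub>s \<in> idempotents S"
  by (simp add: idempotents_def zero_closed zero_left)

lemma C_idem: "c \<in> C \<Longrightarrow> c \<in> idempotents S" and C_carrier: "c \<in> C \<Longrightarrow> c \<in> carrier S"
  using reps_idem[OF coh] idemD by auto

lemma greenD_sym: "sym (greenD S)"
  using greenD_equiv by (rule equivE)

lemma repr_props:
  assumes "f \<in> idempotents S"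
  shows repr_mem: "repr f \<in> C" and repr_greenD: "(repr f, f) \<in> greenD S"
proof -
  have d: "Dclass S f \<in> Dclasses S" by (rule Dclass_mem(1)[OF idemD(1)[OF assms]])
  show "repr f \<in> C" unfolding repr_def by (rule rep_mem(1)[OF coh d])
  have "(f, repr f) \<in> greenD S"
    unfolding repr_def using rep_mem(2)[OF coh d] by (simp add: Dclass_def)
  then show "(repr f, f) \<in> greenD S"
    by (rule symD[OF greenD_sym])
qed

lemma repr_zero_iff:
  assumes "f \<in> idempotents S" shows "repr f = \<zero>\<^sub>s \<longleftrightarrow> f = \<zero>\<^sub>s"
proof -
  have "f \<in> Dclass S (repr f)" using repr_greenD[OF assms] by (simp add: Dclass_def)
  moreover have "repr f \<in> Dclass S f"
    unfolding repr_def by (rule rep_mem(2)[OF coh Dclass_mem(1)[OF idemD(1)[OF assms]]])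
  ultimately show ?thesis using Dclass_zero by (metis singletonD)
qed

lemma repr_id: "c \<in> C \<Longrightarrow> repr c = c"
  unfolding repr_def by (rule rep_Dclass[OF coh])

lemma repr_eq_iff_mem: "f \<in> idempotents S \<Longrightarrow> repr f = f \<longleftrightarrow> f \<in> C"
  using repr_id repr_mem by metis

lemma repr_eqI:
  assumes "(f, g) \<in> greenD S" shows "repr f = repr g"
  unfolding repr_def Dclass_def using assms equiv_class_eq[OF greenD_equiv] by metis

text \<open>The three coherence conditions quantify over \<open>\<D>\<close>-classes. Here and in the next two lemmas they
  are stated for the elements of \<open>C\<close> themselves.\<close>

lemma C_mult: assumes "c \<in> C" "d \<in> C" shows "c \<cdot> d \<in> C"
  using reps_mult[OF coh, of "Dclass S c" "Dclass S d"] Dclass_mem(1) C_carrier assms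
  by (simp add: rep_Dclass[OF coh])

lemma C_interval:
  assumes "c \<in> C" "d \<in> C" "f \<in> idempotents S" "c \<noteq> \<zero>\<^sub>s" "c \<cdot> f = c" "f \<cdot> d = f"
  shows "f \<in> C"
proof -
  have "\<forall>u \<in> Dclasses S. \<forall>v \<in> Dclasses S. \<forall>f \<in> idempotents S.
        rep C u \<noteq> \<zero>\<^sub>s \<and> nat_le S (rep C u) f \<and> nat_le S f (rep C v) \<longrightarrow> f \<in> C"
    using coh by (simp add: coherent_def)
  from this[rule_format, of "Dclass S c" "Dclass S d" f] assms show ?thesis
    by (simp add: rep_Dclass[OF coh] C_carrier C_idem Dclass_mem nat_le_idem_iff)
qed

lemma covered_mult_mem_C:
  assumes d: "d \<in> C" and f: "f \<lless> d" and g: "g \<lless> d" and "f \<noteq> g"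
  shows "f \<cdot> g \<in> C"
proof -
  have i: "f \<in> idempotents S" "g \<in> idempotents S" using f g by (auto simp: covered_by_iff)
  have "f \<cdot> g \<noteq> f" "g \<cdot> f \<noteq> g" using assms i unfolding covered_by_iff by metis+
  moreover have "\<forall>v \<in> Dclasses S. \<forall>f \<in> idempotents S. \<forall>g \<in> idempotents S.
        covered_by S f (rep C v) \<and> covered_by S g (rep C v) \<and>
        \<not> nat_le S f g \<and> \<not> nat_le S g f \<longrightarrow> f \<cdot> g \<in> C"
    using coh by (simp add: coherent_def)
  from this[rule_format, of "Dclass S d" f g] have "\<lbrakk>f \<cdot> g \<noteq> f; g \<cdot> f \<noteq> g\<rbrakk> \<Longrightarrow> f \<cdot> g \<in> C"
    using d f g i by (simp add: rep_Dclass[OF coh] C_carrier Dclass_mem nat_le_idem_iff)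
  ultimately show ?thesis by blast
qed

lemma finite_intervals_relpow:
  assumes "e \<in> idempotents S" "f \<in> idempotents S" "e \<noteq> \<zero>\<^sub>s" "e \<cdot> f = e"
  shows "\<exists>n. (covered_by S ^^ n) e f"
proof -
  obtain hs where hs: "hs \<noteq> []" "hd hs = e" "last hs = f" "successively (covered_by S) hs"
    using finite_intervals assms unfolding finite_intervals_def by (metis nat_le_idem_iff)
  have "(covered_by S ^^ (length hs - 1)) (hd hs) (last hs)"
    if "hs \<noteq> []" "successively (covered_by S) hs" for hs
    using that
  proof (induction hs rule: induct_list012)
    case (3 x y zs)
    then have "(covered_by S ^^ (length (y # zs) - 1)) y (last (y # zs))" "x \<lless> y" by simp_all
    then show ?case using relpowp_Suc_I2[of "covered_by S" x y] by simp
  qed simp_all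
  then show ?thesis using hs by blast
qed

lemma below_proper_covered:
  assumes "e \<in> idempotents S" "f \<in> idempotents S" "e \<noteq> \<zero>\<^sub>s" "e \<cdot> f = e" "e \<noteq> f"
  shows "\<exists>g. e \<cdot> g = e \<and> g \<lless> f"
proof -
  obtain n where n: "(covered_by S ^^ n) e f" using finite_intervals_relpow[OF assms(1-4)] by blast
  with \<open>e \<noteq> f\<close> obtain m where "n = Suc m" by (cases n) auto
  with n obtain g where "(covered_by S ^^ m) e g" "g \<lless> f" by auto
  then show ?thesis using relpow_covered_le assms(1) by blast
qed

text \<open>The pairs \<open>(e\<^sub>v, f)\<close> for which \<open>(v, f)\<close> is the label of an edge: a descending chain of covers leaves
  \<open>C\<close> in the step from \<open>e\<^sub>v\<close> to \<open>f\<close>.\<close>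

definition exit :: "'a \<Rightarrow> 'a \<Rightarrow> bool" where
  "exit e f \<longleftrightarrow> e \<in> nzC \<and> f \<lless> e \<and> f \<noteq> \<zero>\<^sub>s \<and> f \<notin> C"

lemma exitD:
  assumes "exit e f"
  shows "e \<in> C" "e \<noteq> \<zero>\<^sub>s" "f \<lless> e" "f \<noteq> \<zero>\<^sub>s" "f \<notin> C" "f \<in> idempotents S" "f \<cdot> e = f" "e \<cdot> f = f"
    "e \<in> idempotents S" "e \<in> carrier S" "f \<in> carrier S"
  using assms idem_commute[of e f] by (auto simp: exit_def covered_by_iff C_idem idemD)

lemma exit_above_no_C:
  assumes "exit e f" "c \<in> C" "c \<cdot> f = c" shows "c = \<zero>\<^sub>s"
  using C_interval[of c e f] exitD[OF assms(1)] assms by blast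

text \<open>If \<open>e\<close> is not below \<open>c\<close> but \<open>c f \<noteq> 0\<close>, then the nonzero element \<open>e c\<close> of \<open>C\<close> lies strictly below \<open>e\<close>, hence below some
  \<open>g \<lless> e\<close>, and \<open>g \<in> C\<close> by the interval condition. So \<open>g \<noteq> f\<close>, and \<open>f g\<close> is an element of \<open>C\<close> below
  \<open>f\<close>, that is, \<open>0\<close>. But \<open>c f = e c f\<close> is below \<open>f g\<close>, a contradiction.\<close>

lemma exit_mult_C:
  assumes ef: "exit e f" and c: "c \<in> C" and nz: "c \<cdot> f \<noteq> \<zero>\<^sub>s"
  shows "e \<cdot> c = e"
proof (rule ccontr)
  assume ne: "e \<cdot> c \<noteq> e"
  note ef' = exitD[OF ef]
  define m where "m = e \<cdot> c"
  have cc: "c \<in> carrier S" and ci: "c \<in> idempotents S" using c by (simp_all add: C_carrier C_idem)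
  have m: "m \<in> C" "m \<in> idempotents S" "m \<in> carrier S" "m \<cdot> e = m"
    using C_mult[OF ef'(1) c] C_idem C_carrier
      mult_assoc[OF ef'(10) cc ef'(10)] idem_commute[OF ci ef'(9)]
      mult_assoc[OF ef'(10) ef'(10) cc] idemD(2)[OF ef'(9)] by (auto simp: m_def)
  have mf: "m \<cdot> f = c \<cdot> f"
    using mult_assoc[OF cc ef'(10,11)] ef'(8) idem_commute[OF ci ef'(9)] by (simp add: m_def)
  have "m \<noteq> \<zero>\<^sub>s" using mf nz zero_left[OF ef'(11)] by auto
  then obtain g where g: "m \<cdot> g = m" "g \<lless> e"
    using below_proper_covered[OF m(2) ef'(9) _ m(4)] ne by (auto simp: m_def)
  then have gi: "g \<in> idempotents S" "g \<in> carrier S" "g \<cdot> e = g" by (auto simp: covered_by_iff idemD)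
  have "g \<in> C" using C_interval[OF m(1) ef'(1) gi(1) \<open>m \<noteq> \<zero>\<^sub>s\<close> g(1) gi(3)] .
  then have "f \<noteq> g" using ef'(5) by auto
  then have fg: "f \<cdot> g \<in> C" by (rule covered_mult_mem_C[OF ef'(1,3) g(2)])
  have gf: "f \<cdot> g = g \<cdot> f" by (rule idem_commute[OF ef'(6) gi(1)])
  have "f \<cdot> g \<cdot> f = f \<cdot> g"
    unfolding gf using mult_assoc[OF gi(2) ef'(11,11)] idemD(2)[OF ef'(6)] by simp
  then have "f \<cdot> g = \<zero>\<^sub>s" by (rule exit_above_no_C[OF ef fg])
  moreover have "m \<cdot> f = m \<cdot> (f \<cdot> g)"
    using mult_assoc[OF m(3) gi(2) ef'(11)] g(1) gf by simp
  ultimately show False using mf nz zero_right[OF m(3)] by simp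
qed

text \<open>If \<open>f g \<noteq> 0\<close>, then \<open>e g \<noteq> 0\<close> and \<open>d f \<noteq> 0\<close>, so \<open>e\<close> and \<open>d\<close> lie below each other. Thus \<open>f\<close> and \<open>g\<close> are
  distinct elements covered by \<open>e = d\<close>, and the third coherence condition puts \<open>f g\<close> into \<open>C\<close>. No
  nonzero element of \<open>C\<close> is below \<open>f\<close>.\<close>

lemma exit_disjoint:
  assumes ef: "exit e f" and dg: "exit d g" and ne: "(e, f) \<noteq> (d, g)"
  shows "f \<cdot> g = \<zero>\<^sub>s"
proof (rule ccontr)
  assume nz: "f \<cdot> g \<noteq> \<zero>\<^sub>s"
  note a = exitD[OF ef] and b = exitD[OF dg]
  have gf: "f \<cdot> g = g \<cdot> f" by (rule idem_commute[OF a(6) b(6)])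
  have "f \<cdot> g = f \<cdot> (e \<cdot> g)" using mult_assoc[OF a(11,10) b(11)] a(7) by simp
  then have "e \<cdot> g \<noteq> \<zero>\<^sub>s" using nz zero_right[OF a(11)] by auto
  then have 1: "d \<cdot> e = d" by (rule exit_mult_C[OF dg a(1)])
  have "f \<cdot> g = g \<cdot> (d \<cdot> f)" using mult_assoc[OF b(11,10) a(11)] b(7) gf by simp
  then have "d \<cdot> f \<noteq> \<zero>\<^sub>s" using nz zero_right[OF b(11)] by auto
  then have 2: "e \<cdot> d = e" by (rule exit_mult_C[OF ef b(1)])
  have "e = d" using 1 2 idem_commute[OF a(9) b(9)] by simp
  then have "f \<cdot> g \<in> C" using ne by (intro covered_mult_mem_C[OF a(1,3)]) (use b(3) in auto)
  moreover have "f \<cdot> g \<cdot> f = f \<cdot> g"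
    unfolding gf using mult_assoc[OF b(11) a(11,11)] idemD(2)[OF a(6)] by simp
  ultimately show False using exit_above_no_C[OF ef] nz by blast
qed

section \<open>Words as partial isomorphisms\<close>

text \<open>The partial isomorphism \<open>t\<^sub>f\<close> from \<open>e\<^bsub>[f]\<^esub>\<close> to \<open>f\<close>. The value \<open>0\<close> elsewhere keeps all products of
  such elements in the carrier.\<close>

definition slide :: "'a \<Rightarrow> 'a" where
  "slide f = (if f \<in> idempotents S
     then SOME t. t \<in> carrier S \<and> star t \<cdot> t = repr f \<and> t \<cdot> star t = f else \<zero>\<^sub>s)"

lemma slide_props:
  assumes "f \<in> idempotents S"
  shows "slide f \<in> carrier S" "star (slide f) \<cdot> slide f = repr f" "slide f \<cdot> star (slide f) = f"
proof -
  have "\<exists>t. t \<in> carrier S \<and> star t \<cdot> t = repr f \<and> t \<cdot> star t = f"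
    using greenD_idem_iff[OF C_idem[OF repr_mem[OF assms]] assms] repr_greenD[OF assms] by blast
  from someI_ex[OF this] assms
  show "slide f \<in> carrier S" "star (slide f) \<cdot> slide f = repr f" "slide f \<cdot> star (slide f) = f"
    by (simp_all add: slide_def)
qed

lemma slide_closed: "slide f \<in> carrier S"
  using slide_props(1)[of f] zero_closed by (cases "f \<in> idempotents S") (simp_all add: slide_def)

lemma slide_left: "f \<in> idempotents S \<Longrightarrow> f \<cdot> slide f = slide f"
  using mult_star_mult[OF slide_closed] slide_props(3) by metis

text \<open>Left multiplication by \<open>T\<^sub>\<alpha>\<close>. The product \<open>T\<^sub>\<alpha>\<close> itself would have to be an identity element for the
  empty word, and \<open>S\<close> may have none.\<close>

fun act :: "('a set \<times> 'a) list \<Rightarrow> 'a \<Rightarrow> 'a" where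
  "act [] x = x"
| "act (l # \<alpha>) x = slide (snd l) \<cdot> act \<alpha> x"

lemma act_closed: "x \<in> carrier S \<Longrightarrow> act \<alpha> x \<in> carrier S"
  by (induction \<alpha>) (simp_all add: mult_closed slide_closed)

lemma act_append: "act (\<alpha> @ \<beta>) x = act \<alpha> (act \<beta> x)"
  by (induction \<alpha>) simp_all

lemma act_mult: "\<lbrakk>x \<in> carrier S; y \<in> carrier S\<rbrakk> \<Longrightarrow> act \<alpha> (x \<cdot> y) = act \<alpha> x \<cdot> y"
  by (induction \<alpha>) (simp_all add: act_closed mult_assoc slide_closed)

text \<open>For nonzero \<open>c\<close> and \<open>d\<close> in \<open>C\<close> this says that the class of \<open>d\<close> belongs to \<open>s(B, \<alpha>)\<close>, where \<open>B\<close> is the set of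
  vertices below the class of \<open>c\<close>. Reading the word letter by letter makes it accessible to induction.\<close>

fun reach :: "'a \<Rightarrow> ('a set \<times> 'a) list \<Rightarrow> 'a \<Rightarrow> bool" where
  "reach c [] d \<longleftrightarrow> d \<cdot> c = d"
| "reach c ((v, f) # \<alpha>) d \<longleftrightarrow> v \<in> coh_verts S \<and> exit (rep C v) f \<and> rep C v \<cdot> c = rep C v \<and>
     reach (repr f) \<alpha> d"

lemma exit_repr: "exit e f \<Longrightarrow> repr f \<in> nzC"
  using exitD[of e f] repr_mem repr_zero_iff by auto

lemma reach_mono_left:
  assumes "reach c \<alpha> d" "c \<cdot> c' = c" "c \<in> C" "c' \<in> C" "d \<in> C" shows "reach c' \<alpha> d"
proof (cases \<alpha>)
  case Nil
  then show ?thesis using assms idem_le_trans[of d c c'] by (simp add: C_carrier)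
next
  case (Cons l \<alpha>')
  obtain v f where l: "l = (v, f)" by force
  have "rep C v \<cdot> c' = rep C v"
    using assms Cons l idem_le_trans[of "rep C v" c c'] exitD(1)[of "rep C v" f] by (simp add: C_carrier)
  then show ?thesis using assms Cons l by simp
qed

lemma reach_mono_right:
  assumes "reach c \<alpha> d" "d' \<cdot> d = d'" "c \<in> C" "d' \<in> C" "d \<in> C" shows "reach c \<alpha> d'"
  using assms
proof (induction c \<alpha> d rule: reach.induct)
  case (1 c d)
  then show ?case using idem_le_trans[of d' d c] by (simp add: C_carrier)
next
  case (2 c v f \<alpha> d)
  then show ?case using exit_repr[of "rep C v" f] by simp
qed

lemma reach_trans:
  assumes "reach c \<alpha> d" "reach d \<beta> d'" "c \<in> C" "d \<in> C" "d' \<in> C" shows "reach c (\<alpha> @ \<beta>) d'"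
  using assms
proof (induction c \<alpha> d rule: reach.induct)
  case (1 c d)
  then show ?case using reach_mono_left[of d \<beta> d' c] by simp
next
  case (2 c v f \<alpha> d)
  then show ?case using exit_repr[of "rep C v" f] by simp
qed

lemma reach_suffix:
  assumes "reach c (\<alpha> @ \<beta>) d" "c \<in> nzC" shows "\<exists>c' \<in> nzC. reach c' \<beta> d"
  using assms
proof (induction \<alpha> arbitrary: c)
  case (Cons l \<alpha>)
  then show ?case using exit_repr by (cases l) auto
qed auto

text \<open>Each letter of the word maps its domain \<open>e\<^bsub>[f]\<^esub>\<close> onto \<open>f\<close>, which lies below the domain of the
  letter before it. So \<open>T\<^sub>\<alpha> e\<^sub>d\<close> is a partial isomorphism from \<open>e\<^sub>d\<close> to an idempotent below \<open>c\<close>.\<close>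

lemma reach_act:
  assumes "reach c \<alpha> d" "c \<in> C" "d \<in> C"
  shows "c \<cdot> act \<alpha> d = act \<alpha> d \<and> star (act \<alpha> d) \<cdot> act \<alpha> d = d"
  using assms
proof (induction c \<alpha> d rule: reach.induct)
  case (1 c d)
  then show ?case
    using idem_commute[of c d] by (simp add: C_idem star_idem idemD)
next
  case (2 c v f \<alpha> d)
  let ?y = "act \<alpha> d" and ?t = "slide f"
  have ex: "exit (rep C v) f" and v: "rep C v \<cdot> c = rep C v" using "2.prems" by auto
  note e = exitD[OF ex]
  have r: "repr f \<in> C" using exit_repr[OF ex] by simp
  have IH: "repr f \<cdot> ?y = ?y" "star ?y \<cdot> ?y = d" using 2 r by auto
  note [simp] = act_closed[OF C_carrier[OF \<open>d \<in> C\<close>]] slide_closed star_closed mult_closed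
    C_carrier[OF r] C_carrier[OF \<open>c \<in> C\<close>]
  have "c \<cdot> f = f"
  proof -
    have "f \<cdot> c = f" using idem_le_trans[OF e(11,10) C_carrier[OF \<open>c \<in> C\<close>] e(7) v] .
    then show ?thesis using idem_commute[OF e(6) C_idem[OF \<open>c \<in> C\<close>]] by simp
  qed
  then have "c \<cdot> ?t = ?t"
    using mult_assoc[of c f ?t] e(11) slide_left[OF e(6)] by simp
  then have 1: "c \<cdot> (?t \<cdot> ?y) = ?t \<cdot> ?y" using mult_assoc[of c ?t ?y] by simp
  have "star (?t \<cdot> ?y) \<cdot> (?t \<cdot> ?y) = star ?y \<cdot> ((star ?t \<cdot> ?t) \<cdot> ?y)"
    by (simp add: star_mult mult_assoc)
  also have "\<dots> = d" by (simp add: slide_props(2)[OF e(6)] IH)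
  finally show ?case using 1 by simp
qed

text \<open>Common letters cancel, since \<open>t\<^sub>f\<^sup>* t\<^sub>f = e\<^bsub>[f]\<^esub>\<close> fixes everything that the rest of the word can reach.\<close>

lemma act_common_prefix:
  assumes "reach c (\<beta> @ \<gamma>) d" "c \<in> C" "d \<in> C" "z \<in> carrier S"
  shows "star (act (\<beta> @ \<gamma>) d) \<cdot> act \<beta> z = star (act \<gamma> d) \<cdot> z"
  using assms
proof (induction \<beta> arbitrary: c)
  case (Cons l \<beta>)
  obtain v f where l: "l = (v, f)" by force
  have ex: "exit (rep C v) f" and rch: "reach (repr f) (\<beta> @ \<gamma>) d" using Cons.prems l by auto
  have r: "repr f \<in> C" using exit_repr[OF ex] by simp
  let ?y = "act (\<beta> @ \<gamma>) d" and ?t = "slide f" and ?z = "act \<beta> z"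
  note [simp] = act_closed[OF C_carrier[OF \<open>d \<in> C\<close>]] slide_closed star_closed mult_closed
    C_carrier[OF r] act_closed[OF \<open>z \<in> carrier S\<close>]
  have "star (?t \<cdot> ?y) \<cdot> (?t \<cdot> ?z) = star ?y \<cdot> (star ?t \<cdot> ?t) \<cdot> ?z"
    by (simp add: star_mult mult_assoc)
  also have "\<dots> = star (repr f \<cdot> ?y) \<cdot> ?z"
    by (simp add: slide_props(2)[OF exitD(6)[OF ex]] star_mult star_idem C_idem r)
  also have "\<dots> = star ?y \<cdot> ?z" using reach_act[OF rch r \<open>d \<in> C\<close>] by simp
  also have "\<dots> = star (act \<gamma> d) \<cdot> z" using Cons.IH[OF rch r Cons.prems(3,4)] .
  finally show ?case by (simp add: l)
qed simp

lemma act_first: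
  assumes "reach c ((v, f) # \<alpha>) d" "x \<in> carrier S"
  shows "f \<cdot> act ((v, f) # \<alpha>) x = act ((v, f) # \<alpha>) x"
proof -
  have f: "f \<in> idempotents S" using assms exitD(6)[of "rep C v" f] by simp
  show ?thesis
    using mult_assoc[OF idemD(1)[OF f] slide_closed[of f] act_closed[OF assms(2), of \<alpha>]]
    by (simp add: slide_left[OF f])
qed

text \<open>The range of \<open>T\<^sub>\<alpha> e\<^sub>d\<close> is below the first \<open>f\<close>, which every \<open>c \<in> C\<close> either fixes or annihilates.\<close>

lemma act_C_mult:
  assumes "reach c' ((v, f) # \<alpha>) d" "c \<in> C" "d \<in> C" "c' \<in> C"
  shows "c \<cdot> act ((v, f) # \<alpha>) d = (if rep C v \<cdot> c = rep C v then act ((v, f) # \<alpha>) d else \<zero>\<^sub>s)"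
proof (cases "rep C v \<cdot> c = rep C v")
  case True
  then have "reach c ((v, f) # \<alpha>) d" using assms(1) by simp
  then show ?thesis using reach_act assms True by metis
next
  case False
  have ex: "exit (rep C v) f" using assms by simp
  then have "c \<cdot> f = \<zero>\<^sub>s" using exit_mult_C[OF ex assms(2)] False by blast
  let ?y = "act ((v, f) # \<alpha>) d"
  have y: "?y \<in> carrier S" by (intro act_closed C_carrier assms)
  have "c \<cdot> ?y = c \<cdot> f \<cdot> ?y"
    using act_first[OF assms(1) C_carrier[OF assms(3)]]
      mult_assoc[OF C_carrier[OF assms(2)] exitD(11)[OF ex] y] by simp
  then show ?thesis using \<open>c \<cdot> f = \<zero>\<^sub>s\<close> zero_left[OF y] False by simp
qed

lemma act_orthogonal:
  assumes "reach c ((v, f) # \<alpha>) d" "reach c' ((u, g) # \<beta>) d'" "(v, f) \<noteq> (u, g)"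
    and "x \<in> carrier S" "y \<in> carrier S"
  shows "star (act ((v, f) # \<alpha>) x) \<cdot> act ((u, g) # \<beta>) y = \<zero>\<^sub>s"
proof -
  let ?x = "act ((v, f) # \<alpha>) x" and ?y = "act ((u, g) # \<beta>) y"
  have ex: "exit (rep C v) f" "exit (rep C u) g" and uv: "u \<in> coh_verts S" "v \<in> coh_verts S"
    using assms by auto
  have "(rep C v, f) \<noteq> (rep C u, g)"
    using assms(3) uv Dclass_rep[OF coh] unfolding coh_vert_iff[OF coh] by (metis prod.inject)
  then have fg: "f \<cdot> g = \<zero>\<^sub>s" by (rule exit_disjoint[OF ex])
  note [simp] = act_closed[OF assms(4)] act_closed[OF assms(5)] exitD(11)[OF ex(1)]
    exitD(11)[OF ex(2)] star_closed mult_closed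
  have "star ?x \<cdot> ?y = star (f \<cdot> ?x) \<cdot> (g \<cdot> ?y)"
    using act_first[OF assms(1,4)] act_first[OF assms(2,5)] by simp
  also have "\<dots> = star ?x \<cdot> (f \<cdot> g) \<cdot> ?y"
    by (simp add: star_mult star_idem[OF exitD(6)[OF ex(1)]] mult_assoc del: act.simps)
  also have "\<dots> = \<zero>\<^sub>s" by (simp add: fg zero_left zero_right del: act.simps)
  finally show ?thesis .
qed

text \<open>Induction on the length of the chain, from its upper end. If the first step stays in \<open>C\<close>, the word
  for the shorter chain is also good for \<open>e\<close>. If it leaves \<open>C\<close> at \<open>k\<close>, conjugation by \<open>t\<^sub>k\<close> moves the
  shorter chain below \<open>e\<^bsub>[k]\<^esub>\<close>, and the letter for \<open>k\<close> is put in front of the word found there.\<close>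

lemma idem_reached:
  assumes "(covered_by S ^^ n) h e" "e \<in> nzC" "h \<in> idempotents S" "h \<noteq> \<zero>\<^sub>s"
  shows "\<exists>\<alpha> w. w \<in> nzC \<and> reach e \<alpha> w \<and> act \<alpha> w \<cdot> star (act \<alpha> w) = h"
  using assms
proof (induction n arbitrary: h e)
  case 0
  then show ?case
    by (intro exI[of _ "[]"] exI[of _ e]) (auto simp: idemD star_idem)
next
  case (Suc n)
  then obtain k where k: "(covered_by S ^^ n) h k" "k \<lless> e" by auto
  have ki: "k \<in> idempotents S" "k \<cdot> e = k" using k(2) by (auto simp: covered_by_iff)
  have hk: "h \<cdot> k = h" using relpow_covered_le[OF k(1) Suc.prems(3)] .
  have "k \<noteq> \<zero>\<^sub>s" using hk Suc.prems(3,4) zero_right idemD(1) by auto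
  show ?case
  proof (cases "k \<in> C")
    case True
    then obtain \<alpha> w where "w \<in> nzC" "reach k \<alpha> w" "act \<alpha> w \<cdot> star (act \<alpha> w) = h"
      using Suc.IH[OF k(1)] \<open>k \<noteq> \<zero>\<^sub>s\<close> Suc.prems by blast
    then show ?thesis using reach_mono_left[of k \<alpha> w e] True ki(2) Suc.prems(2) by blast
  next
    case False
    let ?t = "slide k" and ?h = "conjugate (slide k) h"
    have ex: "exit e k" using False k(2) \<open>k \<noteq> \<zero>\<^sub>s\<close> Suc.prems(2) by (simp add: exit_def)
    note t = slide_props[OF ki(1)]
    note [simp] = t(1) star_closed mult_closed
    have conj_back: "conjugate (star ?t) ?h = h"
      using conjugate_conjugate[OF t(1) Suc.prems(3)] hk t(3) by simp
    have hi: "?h \<in> idempotents S" by (rule conjugate_idem[OF t(1) Suc.prems(3)])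
    have "?h \<noteq> \<zero>\<^sub>s"
    proof
      assume "?h = \<zero>\<^sub>s"
      then have "h = \<zero>\<^sub>s" using conj_back by (simp add: conjugate_def star_star zero_left zero_right)
      then show False using Suc.prems(4) by simp
    qed
    have "conjugate ?t k = repr k"
    proof -
      have "conjugate ?t (?t \<cdot> star ?t) = star ?t \<cdot> ?t"
        by (simp add: conjugate_def mult_assoc star_reassoc)
      then show ?thesis using t by simp
    qed
    then have "(covered_by S ^^ n) ?h (repr k)"
      using relpow_covered_conjugate[OF t(1) k(1)] t(3) ki(1) by (simp add: idemD)
    then obtain \<alpha> w where w: "w \<in> nzC" "reach (repr k) \<alpha> w" "act \<alpha> w \<cdot> star (act \<alpha> w) = ?h"
      using Suc.IH exit_repr[OF ex] hi \<open>?h \<noteq> \<zero>\<^sub>s\<close> by blast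
    have "Dclass S e \<in> coh_verts S" "rep C (Dclass S e) = e"
      using Suc.prems(2) by (auto simp: coh_vert_iff[OF coh] rep_Dclass[OF coh] Dclass_mem C_carrier)
    then have "reach e ((Dclass S e, k) # \<alpha>) w" using ex w(2) Suc.prems(2) C_idem by (auto simp: idemD)
    moreover have "act ((Dclass S e, k) # \<alpha>) w \<cdot> star (act ((Dclass S e, k) # \<alpha>) w) = h"
    proof -
      have [simp]: "act \<alpha> w \<in> carrier S" using w(1) by (simp add: act_closed C_carrier)
      have "?t \<cdot> act \<alpha> w \<cdot> star (?t \<cdot> act \<alpha> w) = ?t \<cdot> (act \<alpha> w \<cdot> star (act \<alpha> w)) \<cdot> star ?t"
        by (simp add: star_mult mult_assoc)
      also have "\<dots> = conjugate (star ?t) ?h" unfolding w(3) by (simp add: conjugate_def star_star)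
      finally show ?thesis using conj_back by simp
    qed
    ultimately show ?thesis using w(1) by blast
  qed
qed

section \<open>The labelled graph space in terms of representatives\<close>

abbreviation "G \<equiv> coh_graph S C"

text \<open>The set \<open>B\<^sub>v\<close> of the labelled graph space, indexed by the idempotent \<open>c = e\<^sub>v\<close>. As the following
  lemmas show, the order and the meets of the sets \<open>B\<^sub>v\<close> are those of \<open>C\<close>.\<close>

definition down :: "'a \<Rightarrow> 'a set set" where "down c = coh_down S C (Dclass S c)"

text \<open>The side condition on a triple \<open>(\<alpha>, B\<^sub>v, \<beta>)\<close> with \<open>w = e\<^sub>v\<close>, for one of its two words: \<open>\<alpha>\<close> is a word
  with \<open>B\<^sub>v \<subseteq> s(\<alpha>)\<close> (see \<open>leads_iff\<close>).\<close>

definition leads :: "('a set \<times> 'a) list \<Rightarrow> 'a \<Rightarrow> bool" where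
  "leads \<alpha> w \<longleftrightarrow> w \<in> nzC \<and> (\<exists>c \<in> nzC. reach c \<alpha> w)"

lemma Dclass_vert: "c \<in> nzC \<Longrightarrow> Dclass S c \<in> coh_verts S"
  by (simp add: coh_vert_iff[OF coh] rep_Dclass[OF coh] Dclass_mem C_carrier)

lemma vert_rep: "v \<in> coh_verts S \<Longrightarrow> rep C v \<in> nzC \<and> Dclass S (rep C v) = v"
  using rep_mem[OF coh] Dclass_rep[OF coh] by (auto simp: coh_vert_iff[OF coh])

lemma down_iff:
  assumes "c \<in> nzC"
  shows "v \<in> down c \<longleftrightarrow> v \<in> coh_verts S \<and> rep C v \<cdot> c = rep C v"
  using assms class_le_iff[OF coh, of v "Dclass S c"] Dclass_mem(1)[of c] C_carrier
  by (auto simp: down_def coh_down_def coh_vert_iff[OF coh] rep_Dclass[OF coh])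

lemma down_subset_iff:
  assumes c: "c \<in> nzC" and d: "d \<in> nzC"
  shows "down c \<subseteq> down d \<longleftrightarrow> c \<cdot> d = c"
proof
  have "Dclass S c \<in> down c"
    using c by (simp add: down_iff[OF c] Dclass_vert rep_Dclass[OF coh] idemD C_idem)
  moreover assume "down c \<subseteq> down d"
  ultimately have "Dclass S c \<in> down d" by blast
  then show "c \<cdot> d = c" using c by (simp add: down_iff[OF d] rep_Dclass[OF coh])
next
  assume le: "c \<cdot> d = c"
  show "down c \<subseteq> down d"
  proof
    fix v assume "v \<in> down c"
    then show "v \<in> down d"
      using le c d vert_rep[of v] C_carrier idem_le_trans[of "rep C v" c d]
      by (simp add: down_iff[OF c] down_iff[OF d])
  qed
qed

lemma down_nonempty: assumes "c \<in> nzC" shows "down c \<noteq> {}"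
proof -
  have "Dclass S c \<in> down c"
    using assms by (simp add: down_iff Dclass_vert rep_Dclass[OF coh] idemD C_idem)
  then show ?thesis by blast
qed

lemma down_inj: assumes "c \<in> nzC" "d \<in> nzC" "down c = down d" shows "c = d"
proof -
  have "c \<cdot> d = c" "d \<cdot> c = d"
    using down_subset_iff[OF assms(1,2)] down_subset_iff[OF assms(2,1)] assms(3) by simp_all
  then show ?thesis using idem_commute[of c d] assms C_idem by simp
qed

lemma coh_sets_eq: "coh_sets S C = insert {} (down ` nzC)"
proof -
  have "{coh_down S C v | v. v \<in> coh_verts S} = down ` nzC"
  proof (intro equalityI subsetI)
    fix A assume "A \<in> {coh_down S C v | v. v \<in> coh_verts S}"
    then obtain v where "v \<in> coh_verts S" "A = coh_down S C v" by blast
    then show "A \<in> down ` nzC"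
      using vert_rep[of v] by (intro image_eqI[of _ _ "rep C v"]) (simp_all add: down_def)
  next
    fix A assume "A \<in> down ` nzC"
    then show "A \<in> {coh_down S C v | v. v \<in> coh_verts S}"
      using Dclass_vert unfolding down_def by blast
  qed
  then show ?thesis by (simp add: coh_sets_def)
qed

lemma down_Int:
  assumes c: "c \<in> nzC" and d: "d \<in> nzC"
  shows "down c \<inter> down d = (if c \<cdot> d = \<zero>\<^sub>s then {} else down (c \<cdot> d))"
proof -
  note cc = C_carrier[of c] C_carrier[of d] C_idem[of c] C_idem[of d]
  have le: "x \<cdot> (c \<cdot> d) = x \<longleftrightarrow> x \<cdot> c = x \<and> x \<cdot> d = x" if x: "x \<in> carrier S" for x
  proof
    assume h: "x \<cdot> (c \<cdot> d) = x"
    have "c \<cdot> d \<cdot> d = c \<cdot> d" using cc c d by (simp add: mult_assoc idemD)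
    moreover have "c \<cdot> d \<cdot> c = c \<cdot> d"
      using cc c d idem_commute[of c d] mult_assoc[of d c c] by (simp add: idemD)
    ultimately show "x \<cdot> c = x \<and> x \<cdot> d = x"
      using idem_le_trans[OF x _ _ h] cc c d by (simp add: mult_closed)
  next
    assume "x \<cdot> c = x \<and> x \<cdot> d = x"
    then show "x \<cdot> (c \<cdot> d) = x" using mult_assoc[of x c d] x cc c d by simp
  qed
  have v: "v \<in> down c \<inter> down d \<longleftrightarrow> v \<in> coh_verts S \<and> rep C v \<cdot> (c \<cdot> d) = rep C v" for v
    using le[of "rep C v"] vert_rep[of v] C_carrier by (auto simp: down_iff[OF c] down_iff[OF d])
  show ?thesis
  proof (cases "c \<cdot> d = \<zero>\<^sub>s")
    case True
    have "rep C v \<cdot> \<zero>\<^sub>s \<noteq> rep C v" if "v \<in> coh_verts S" for v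
      using vert_rep[OF that] C_carrier zero_right by auto
    then show ?thesis using v True by auto
  next
    case False
    then have y: "c \<cdot> d \<in> nzC" using C_mult c d by simp
    have "down c \<inter> down d = down (c \<cdot> d)"
      by (rule Set.set_eqI) (unfold v down_iff[OF y], rule refl)
    then show ?thesis using False by simp
  qed
qed

lemma arcs_iff:
  "(v, f, u) \<in> arcs G \<longleftrightarrow> v \<in> coh_verts S \<and> exit (rep C v) f \<and> u \<in> coh_verts S \<and>
     rep C u \<cdot> repr f = rep C u"
proof -
  have "u \<in> coh_down S C (Dclass S f) \<longleftrightarrow> u \<in> coh_verts S \<and> rep C u \<cdot> repr f = rep C u"
    if "f \<in> idempotents S" for u f
    using class_le_iff[OF coh, of u "Dclass S f"] Dclass_mem(1)[OF idemD(1)[OF that]]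
    by (auto simp: coh_down_def coh_vert_iff[OF coh] repr_def)
  moreover have "f \<noteq> rep C (Dclass S f) \<longleftrightarrow> f \<notin> C" if "f \<in> idempotents S" for f
    using repr_eq_iff_mem[OF that] by (auto simp: repr_def)
  moreover have "f \<in> idempotents S" if "f \<lless> e" for e f using that by (simp add: covered_by_iff)
  ultimately show ?thesis
    using vert_rep[of v] by (auto simp: coh_graph_def exit_def)
qed

lemma coh_graph_simps [simp]: "head G (v, f, u) = v" "tail G (v, f, u) = u" "verts G = coh_verts S"
  by (simp_all add: coh_graph_def)

lemma path_reach:
  assumes "is_path G p" "d \<in> nzC" "d \<cdot> repr (fst (snd (last p))) = d"
  shows "reach (rep C (head G (hd p))) (map coh_lab p) d"
  using assms
proof (induction p)
  case (Cons a p)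
  obtain v f u where a: "a = (v, f, u)" by (metis prod_cases3)
  have "a \<in> arcs G" using Cons.prems(1) by (simp add: is_path_def)
  then have arc: "v \<in> coh_verts S" "exit (rep C v) f" "u \<in> coh_verts S" "rep C u \<cdot> repr f = rep C u"
    unfolding a arcs_iff by auto
  have vv: "rep C v \<cdot> rep C v = rep C v" using vert_rep[OF arc(1)] C_idem idemD by blast
  show ?case
  proof (cases "p = []")
    case True
    then show ?thesis using Cons.prems a arc vv by (simp add: coh_lab_def)
  next
    case False
    then have "is_path G p" "u = head G (hd p)"
      using Cons.prems(1) a by (auto simp: is_path_def successively_Cons)
    then have "reach (rep C u) (map coh_lab p) d"
      using Cons.IH Cons.prems False by simp
    then have "reach (repr f) (map coh_lab p) d"
      using reach_mono_left arc(4) vert_rep[OF arc(3)] exit_repr[OF arc(2)] Cons.prems(2) by blast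
    then show ?thesis using a arc vv by (simp add: coh_lab_def)
  qed
qed (simp add: is_path_def)

lemma reach_path:
  assumes "reach c \<alpha> d" "\<alpha> \<noteq> []" "d \<in> nzC"
  shows "\<exists>p. is_path G p \<and> map coh_lab p = \<alpha> \<and> head G (hd p) = fst (hd \<alpha>) \<and>
    d \<cdot> repr (fst (snd (last p))) = d"
  using assms
proof (induction \<alpha> arbitrary: c)
  case (Cons l \<alpha>)
  obtain v f where l: "l = (v, f)" by force
  have v: "v \<in> coh_verts S" "exit (rep C v) f" "reach (repr f) \<alpha> d" using Cons.prems l by auto
  show ?case
  proof (cases "\<alpha> = []")
    case True
    then have "(v, f, Dclass S d) \<in> arcs G"
      using v Cons.prems(3) by (simp add: arcs_iff Dclass_vert rep_Dclass[OF coh])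
    then show ?thesis
      using True l v by (intro exI[of _ "[(v, f, Dclass S d)]"]) (simp add: is_path_def coh_lab_def)
  next
    case False
    then obtain p where p: "is_path G p" "map coh_lab p = \<alpha>" "head G (hd p) = fst (hd \<alpha>)"
      "d \<cdot> repr (fst (snd (last p))) = d"
      using Cons.IH v Cons.prems by blast
    have "(v, f, fst (hd \<alpha>)) \<in> arcs G"
      using v False by (cases \<alpha>) (auto simp: arcs_iff)
    moreover have "p \<noteq> []" using p(1) by (simp add: is_path_def)
    ultimately show ?thesis
      using p l by (intro exI[of _ "(v, f, fst (hd \<alpha>)) # p"])
        (simp add: is_path_def coh_lab_def successively_Cons)
  qed
qed simp

lemma rel_source_path:
  assumes "is_path G p"
  shows "rel_source G coh_lab A (map coh_lab p) =
    (if head G (hd p) \<in> A then down (repr (fst (snd (last p)))) else {})"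
    and "repr (fst (snd (last p))) \<in> nzC" and "head G (hd p) \<in> coh_verts S"
proof -
  obtain v f u where l: "last p = (v, f, u)" by (metis prod_cases3)
  have "last p \<in> arcs G" "hd p \<in> arcs G" using assms by (auto simp: is_path_def)
  then have f: "exit (rep C v) f" unfolding l arcs_iff by simp
  have "Dclass S (repr f) = Dclass S f"
    unfolding Dclass_def
    using equiv_class_eq[OF greenD_equiv repr_greenD[OF exitD(6)[OF f]]] .
  then show "rel_source G coh_lab A (map coh_lab p) =
    (if head G (hd p) \<in> A then down (repr (fst (snd (last p)))) else {})"
    using coh_rel_source[OF coh assms] l by (simp add: down_def)
  show "repr (fst (snd (last p))) \<in> nzC" using exit_repr[OF f] l by simp
  obtain v' f' u' where h: "hd p = (v', f', u')" by (metis prod_cases3)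
  show "head G (hd p) \<in> coh_verts S" using \<open>hd p \<in> arcs G\<close> unfolding h arcs_iff by simp
qed

text \<open>Compare with \<open>act_C_mult\<close>: the set is cut down to \<open>\<emptyset>\<close> exactly when the element of \<open>C\<close>
  annihilates the product for the word.\<close>

lemma rel_source_Int_down:
  assumes "reach c ((v, f) # \<gamma>) x" "x \<in> nzC" "w \<in> nzC"
  shows "rel_source G coh_lab (down w) ((v, f) # \<gamma>) \<inter> down x =
    (if rep C v \<cdot> w = rep C v then down x else {})"
proof -
  obtain p where p: "is_path G p" "map coh_lab p = (v, f) # \<gamma>" "head G (hd p) = v"
    "x \<cdot> repr (fst (snd (last p))) = x"
    using reach_path[OF assms(1) _ assms(2)] by auto
  have "v \<in> coh_verts S" using assms(1) by simp
  moreover have "down x \<subseteq> down (repr (fst (snd (last p))))"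
    using p(4) down_subset_iff[OF assms(2) rel_source_path(2)[OF p(1)]] by simp
  ultimately show ?thesis
    using rel_source_path(1)[OF p(1), of "down w"] p(2,3) by (auto simp: down_iff[OF assms(3)])
qed

lemma leads_iff:
  assumes w: "w \<in> nzC"
  shows "leads \<alpha> w \<longleftrightarrow> \<alpha> \<in> words G coh_lab \<and> down w \<subseteq> source_set G coh_lab \<alpha>"
proof (cases "\<alpha> = []")
  case True
  have "reach w [] w" using w by (simp add: idemD C_idem)
  then show ?thesis using w True
    by (auto simp: leads_def words_def source_set_def rel_source_def down_iff)
next
  case False
  show ?thesis
  proof
    assume "leads \<alpha> w"
    then obtain c where "reach c \<alpha> w" by (auto simp: leads_def)
    then obtain p where p: "is_path G p" "map coh_lab p = \<alpha>" "w \<cdot> repr (fst (snd (last p))) = w"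
      using reach_path False w by blast
    have "Suc 0 \<le> length p" using p(1) by (cases p) (auto simp: is_path_def)
    then have "\<alpha> \<in> words G coh_lab"
      using p(1,2) by (auto simp: words_def words_ge1_def words_of_length_def)
    moreover have "down w \<subseteq> source_set G coh_lab \<alpha>"
      using rel_source_path[OF p(1)] p(2,3) down_subset_iff[OF w] by (simp add: source_set_def)
    ultimately show "\<alpha> \<in> words G coh_lab \<and> down w \<subseteq> source_set G coh_lab \<alpha>" by blast
  next
    assume a: "\<alpha> \<in> words G coh_lab \<and> down w \<subseteq> source_set G coh_lab \<alpha>"
    then obtain p where p: "is_path G p" "map coh_lab p = \<alpha>"
      using False by (auto simp: words_def words_ge1_def words_of_length_def)
    have "w \<cdot> repr (fst (snd (last p))) = w"
      using a rel_source_path[OF p(1)] p(2) down_subset_iff[OF w] by (auto simp: source_set_def)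
    then have "reach (rep C (head G (hd p))) \<alpha> w" using path_reach[OF p(1) w] p(2) by simp
    then show "leads \<alpha> w"
      unfolding leads_def using w vert_rep rel_source_path(3)[OF p(1)] by blast
  qed
qed

lemma carrier_coh_semigroup:
  "carrier (coh_semigroup S C) =
     insert None {Some (\<alpha>, down w, \<beta>) | \<alpha> w \<beta>. leads \<alpha> w \<and> leads \<beta> w}"
proof -
  have 1: "x \<in> carrier (coh_semigroup S C) \<longleftrightarrow> x = None \<or> (\<exists>\<alpha> w \<beta>. x = Some (\<alpha>, down w, \<beta>) \<and>
      w \<in> nzC \<and> (\<alpha> \<in> words G coh_lab \<and> down w \<subseteq> source_set G coh_lab \<alpha>) \<and>
      (\<beta> \<in> words G coh_lab \<and> down w \<subseteq> source_set G coh_lab \<beta>))" for x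
    unfolding coh_semigroup_def lgs_semigroup_def coh_sets_eq using down_nonempty by auto
  have 2: "w \<in> nzC \<and> (\<alpha> \<in> words G coh_lab \<and> down w \<subseteq> source_set G coh_lab \<alpha>) \<and>
      (\<beta> \<in> words G coh_lab \<and> down w \<subseteq> source_set G coh_lab \<beta>) \<longleftrightarrow> leads \<alpha> w \<and> leads \<beta> w" for \<alpha> \<beta> w
    using leads_iff[of w \<alpha>] leads_iff[of w \<beta>] unfolding leads_def by blast
  show ?thesis by (rule Set.set_eqI) (simp only: 1 2 insert_iff mem_Collect_eq)
qed

section \<open>The embedding of the labelled graph inverse semigroup\<close>

definition top_of :: "'a set set \<Rightarrow> 'a" where
  "top_of A = (THE c. c \<in> nzC \<and> A = down c)"

lemma top_of_down: "c \<in> nzC \<Longrightarrow> top_of (down c) = c"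
  unfolding top_of_def by (rule the_equality) (use down_inj in auto)

fun embed :: "('a set, 'a set \<times> 'a) lgs_elem \<Rightarrow> 'a" where
  "embed None = \<zero>\<^sub>s"
| "embed (Some (\<alpha>, A, \<beta>)) = act \<alpha> (top_of A) \<cdot> star (act \<beta> (top_of A))"

lemma embed_Some: "w \<in> nzC \<Longrightarrow> embed (Some (\<alpha>, down w, \<beta>)) = act \<alpha> w \<cdot> star (act \<beta> w)"
  by (simp add: top_of_down)

declare embed.simps(2) [simp del]

lemma leads_act:
  assumes "leads \<alpha> w"
  shows "w \<in> C" "w \<noteq> \<zero>\<^sub>s" "w \<in> carrier S" "w \<in> idempotents S" "act \<alpha> w \<in> carrier S"
    "star (act \<alpha> w) \<cdot> act \<alpha> w = w" "act \<alpha> w \<cdot> w = act \<alpha> w"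
proof -
  show w: "w \<in> C" "w \<noteq> \<zero>\<^sub>s" "w \<in> carrier S" "w \<in> idempotents S"
    using assms C_carrier C_idem by (auto simp: leads_def)
  show a: "act \<alpha> w \<in> carrier S" by (rule act_closed[OF w(3)])
  show "star (act \<alpha> w) \<cdot> act \<alpha> w = w" using assms reach_act by (auto simp: leads_def)
  then show "act \<alpha> w \<cdot> w = act \<alpha> w" using star_reassoc(1)[OF a] by simp
qed

lemma leads_mono:
  assumes "leads \<alpha> w" "w' \<in> nzC" "w' \<cdot> w = w'" shows "leads \<alpha> w'"
  using assms reach_mono_right[of _ \<alpha> w w'] by (auto simp: leads_def)

lemma leads_append:
  assumes "leads \<alpha> w" "reach w \<gamma> x" "x \<in> nzC" shows "leads (\<alpha> @ \<gamma>) x"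
  using assms reach_trans[of _ \<alpha> w \<gamma> x] by (auto simp: leads_def)

text \<open>The middle factor \<open>e\<^sub>w T\<^sub>\<beta>\<^sup>* T\<^sub>\<gamma> e\<^sub>x\<close> of the product of two images, when the second word extends the first.\<close>

lemma star_act_act:
  assumes \<beta>: "leads \<beta> w" and \<gamma>: "leads (\<beta> @ \<gamma>) x"
  shows "star (act \<beta> w) \<cdot> act (\<beta> @ \<gamma>) x = w \<cdot> act \<gamma> x"
proof -
  obtain c where c: "c \<in> C" "reach c \<beta> w" using \<beta> by (auto simp: leads_def)
  have "act \<gamma> x \<in> carrier S" using leads_act(3)[OF \<gamma>] by (rule act_closed)
  then show ?thesis
    using act_common_prefix[of c \<beta> "[]" w] c leads_act[OF \<beta>] by (simp add: act_append star_idem)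
qed

text \<open>The middle factor for incomparable words: the common prefix cancels, and the next letters, being
  distinct, have orthogonal ranges.\<close>

lemma star_act_act_orthogonal:
  assumes \<beta>: "leads \<beta> w" and \<gamma>: "leads \<gamma> x" and par: "\<beta> \<parallel> \<gamma>"
  shows "star (act \<beta> w) \<cdot> act \<gamma> x = \<zero>\<^sub>s"
proof -
  obtain \<zeta> b \<beta>' c \<gamma>' where bc: "b \<noteq> c" "\<beta> = \<zeta> @ b # \<beta>'" "\<gamma> = \<zeta> @ c # \<gamma>'"
    using parallel_decomp[OF par] by blast
  obtain k where k: "k \<in> nzC" "reach k \<beta> w" using \<beta> by (auto simp: leads_def)
  obtain m where m: "m \<in> nzC" "reach m \<gamma> x" using \<gamma> by (auto simp: leads_def)
  note w = leads_act[OF \<beta>] and x = leads_act[OF \<gamma>]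
  obtain k' m' where "reach k' (b # \<beta>') w" "reach m' (c # \<gamma>') x"
    using reach_suffix[of k \<zeta> _ w] reach_suffix[of m \<zeta> _ x] k m bc by blast
  then have "star (act (b # \<beta>') w) \<cdot> act (c # \<gamma>') x = \<zero>\<^sub>s"
    using act_orthogonal[of k' "fst b" "snd b" \<beta>' w m' "fst c" "snd c" \<gamma>' x w x] bc(1) w(3) x(3)
    by (simp add: prod_eq_iff del: act.simps reach.simps)
  then show ?thesis
    using act_common_prefix[of k \<zeta> "b # \<beta>'" w "act (c # \<gamma>') x"] k bc w x act_closed[OF x(3)]
    by (simp add: act_append[of \<zeta> "c # \<gamma>'"] del: act.simps)
qed

lemma coh_semigroup_cases:
  assumes "a \<in> carrier (coh_semigroup S C)"
  obtains "a = None" | \<alpha> w \<beta> where "a = Some (\<alpha>, down w, \<beta>)" "leads \<alpha> w" "leads \<beta> w" "w \<in> nzC"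
proof (cases "a = None")
  case False
  then obtain \<alpha> w \<beta> where "a = Some (\<alpha>, down w, \<beta>)" "leads \<alpha> w" "leads \<beta> w"
    using assms unfolding carrier_coh_semigroup by auto
  then show ?thesis using that(2) by (simp add: leads_def)
qed (rule that(1))

lemma embed_closed:
  assumes "a \<in> carrier (coh_semigroup S C)" shows "embed a \<in> carrier S"
  using assms
proof (cases rule: coh_semigroup_cases)
  case (2 \<alpha> w \<beta>)
  then show ?thesis by (simp add: embed_Some leads_act(5) mult_closed star_closed)
qed (simp add: zero_closed)

text \<open>The case distinction in the product of triples corresponds to the possible values of the middle
  factor \<open>e\<^sub>w T\<^sub>\<beta>\<^sup>* T\<^sub>\<gamma> e\<^sub>x\<close>: it is \<open>e\<^sub>w e\<^sub>x\<close> for equal words, zero for incomparable ones, and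
  otherwise it is zero or comes from the part of the longer word that exceeds the shorter one.\<close>

lemma product_closed_embed:
  assumes l: "leads \<alpha> w" "leads \<beta> w" "leads \<gamma> x" "leads \<delta> x"
  defines "a \<equiv> Some (\<alpha>, down w, \<beta>)" and "b \<equiv> Some (\<gamma>, down x, \<delta>)"
  shows "lgs_mult G coh_lab a b \<in> carrier (coh_semigroup S C) \<and>
    embed (lgs_mult G coh_lab a b) = embed a \<cdot> embed b"
proof -
  note pa = leads_act[OF l(1)] and pb = leads_act[OF l(2)] and
    pc = leads_act[OF l(3)] and pd = leads_act[OF l(4)]
  note [simp] = pa(1,2,3,5) pb(5) pc(1,2,3,5) pd(5) star_closed mult_closed
  have w: "w \<in> nzC" and x: "x \<in> nzC" by simp_all
  have ab: "embed a \<cdot> embed b =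
      act \<alpha> w \<cdot> (star (act \<beta> w) \<cdot> act \<gamma> x) \<cdot> star (act \<delta> x)"
    by (simp add: a_def b_def embed_Some w x mult_assoc)
  have None: "None \<in> carrier (coh_semigroup S C) \<and> embed None = embed a \<cdot> embed b"
    if "star (act \<beta> w) \<cdot> act \<gamma> x = \<zero>\<^sub>s"
    unfolding ab that by (simp add: zero_left zero_right carrier_coh_semigroup)
  have Some: "Some (\<mu>, down y, \<nu>) \<in> carrier (coh_semigroup S C) \<and>
      embed (Some (\<mu>, down y, \<nu>)) = embed a \<cdot> embed b"
    if "leads \<mu> y" "leads \<nu> y"
      "act \<mu> y \<cdot> star (act \<nu> y) = act \<alpha> w \<cdot> (star (act \<beta> w) \<cdot> act \<gamma> x) \<cdot> star (act \<delta> x)" for \<mu> y \<nu>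
    unfolding ab that(3)[symmetric] using that(1,2) leads_act(1,2)[OF that(1)]
    by (auto simp: embed_Some carrier_coh_semigroup)
  consider (eq) "\<beta> = \<gamma>" | (left) v f \<gamma>' where "\<gamma> = \<beta> @ (v, f) # \<gamma>'"
    | (right) v f \<beta>' where "\<beta> = \<gamma> @ (v, f) # \<beta>'" | (par) "\<beta> \<parallel> \<gamma>"
  proof -
    have "\<beta> \<parallel> \<gamma> \<or> prefix \<beta> \<gamma> \<or> prefix \<gamma> \<beta>" by blast
    moreover have "\<beta> = \<gamma> \<or> (\<exists>v f \<gamma>'. \<gamma> = \<beta> @ (v, f) # \<gamma>')" if "prefix \<beta> \<gamma>" for \<beta> \<gamma> :: "('a set \<times> 'a) list"
      using that by (metis append_Nil2 neq_Nil_conv prefixE surj_pair)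
    ultimately show thesis using that by blast
  qed
  then show ?thesis
  proof cases
    case eq
    have m: "lgs_mult G coh_lab a b = triple \<alpha> (down w \<inter> down x) \<delta>"
      by (simp add: a_def b_def eq rel_source_def)
    have wx: "star (act \<beta> w) \<cdot> act \<gamma> x = w \<cdot> x"
      using star_act_act[of \<beta> w "[]" x] l eq by simp
    show ?thesis
    proof (cases "w \<cdot> x = \<zero>\<^sub>s")
      case True
      then show ?thesis using None wx m by (simp add: down_Int[OF w x] triple_def)
    next
      case False
      then have y: "w \<cdot> x \<in> nzC" using C_mult w x by simp
      have xw: "w \<cdot> x = x \<cdot> w" by (rule idem_commute[OF pa(4) pc(4)])
      have yy: "w \<cdot> x \<cdot> w = w \<cdot> x" "w \<cdot> x \<cdot> x = w \<cdot> x"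
        using xw mult_assoc[of x w w] mult_assoc[of w x x] idemD(2)[OF pa(4)] idemD(2)[OF pc(4)]
        by simp_all
      have "act \<alpha> (w \<cdot> x) \<cdot> star (act \<delta> (w \<cdot> x)) = act \<alpha> w \<cdot> (w \<cdot> x) \<cdot> star (act \<delta> x)"
      proof -
        have "act \<alpha> (w \<cdot> x) = act \<alpha> w \<cdot> x" by (rule act_mult) simp_all
        moreover have "act \<delta> (w \<cdot> x) = act \<delta> x \<cdot> w" unfolding xw by (rule act_mult) simp_all
        then have "star (act \<delta> (w \<cdot> x)) = w \<cdot> star (act \<delta> x)"
          by (simp add: star_mult star_idem[OF pa(4)])
        ultimately have "act \<alpha> (w \<cdot> x) \<cdot> star (act \<delta> (w \<cdot> x)) = act \<alpha> w \<cdot> (x \<cdot> w) \<cdot> star (act \<delta> x)"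
          by (simp add: mult_assoc)
        then show ?thesis using xw by simp
      qed
      then show ?thesis
        using Some[of \<alpha> "w \<cdot> x" \<delta>] leads_mono[OF l(1) y yy(1)] leads_mono[OF l(4) y yy(2)] wx m False
        by (simp add: down_Int[OF w x] triple_def down_nonempty[OF y])
    qed
  next
    case left
    let ?\<gamma> = "(v, f) # \<gamma>'"
    obtain k where k: "k \<in> nzC" "reach k ?\<gamma> x"
      using l(3) reach_suffix unfolding left leads_def by blast
    have m: "lgs_mult G coh_lab a b = triple (\<alpha> @ ?\<gamma>) (if rep C v \<cdot> w = rep C v then down x else {}) \<delta>"
      using rel_source_Int_down[OF k(2) x w] by (simp add: a_def b_def left)
    have wx: "star (act \<beta> w) \<cdot> act \<gamma> x = (if rep C v \<cdot> w = rep C v then act ?\<gamma> x else \<zero>\<^sub>s)"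
      using star_act_act[OF l(2), of ?\<gamma> x] l(3) act_C_mult[OF k(2)] k w x left
      by (simp del: act.simps)
    show ?thesis
    proof (cases "rep C v \<cdot> w = rep C v")
      case True
      have "reach w ?\<gamma> x" using True k(2) by simp
      then have "leads (\<alpha> @ ?\<gamma>) x" by (rule leads_append[OF l(1) _ x])
      moreover have "act (\<alpha> @ ?\<gamma>) x = act \<alpha> w \<cdot> act ?\<gamma> x"
      proof -
        have "act (\<alpha> @ ?\<gamma>) x = act \<alpha> (w \<cdot> act ?\<gamma> x)"
          using act_C_mult[OF k(2), of w] True w x k by (simp add: act_append del: act.simps)
        then show ?thesis using act_mult[OF pa(3) act_closed[OF pc(3)], of \<alpha> ?\<gamma>] by simp
      qed
      ultimately show ?thesis
        using Some[of "\<alpha> @ ?\<gamma>" x \<delta>] l(4) m wx True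
        by (simp add: triple_def down_nonempty[OF x] del: act.simps)
    next
      case False
      then show ?thesis using None wx m by (simp add: triple_def)
    qed
  next
    case right
    let ?\<beta> = "(v, f) # \<beta>'"
    obtain k where k: "k \<in> nzC" "reach k ?\<beta> w"
      using l(2) reach_suffix unfolding right leads_def by blast
    have "\<not> prefix \<beta> \<gamma>" by (auto simp: right)
    then have m: "lgs_mult G coh_lab a b = triple \<alpha> (if rep C v \<cdot> x = rep C v then down w else {}) (\<delta> @ ?\<beta>)"
      using rel_source_Int_down[OF k(2) w x] by (simp add: a_def b_def right Int_commute)
    have bw: "act ?\<beta> w \<in> carrier S" by (rule act_closed) simp
    have "star (act \<gamma> x) \<cdot> act \<beta> w = (if rep C v \<cdot> x = rep C v then act ?\<beta> w else \<zero>\<^sub>s)"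
      using star_act_act[OF l(3), of ?\<beta> w] l(2) act_C_mult[OF k(2)] k w x right
      by (simp del: act.simps)
    moreover have "star (act \<beta> w) \<cdot> act \<gamma> x = star (star (act \<gamma> x) \<cdot> act \<beta> w)"
      by (simp add: star_mult star_star)
    ultimately have wx: "star (act \<beta> w) \<cdot> act \<gamma> x =
        (if rep C v \<cdot> x = rep C v then star (act ?\<beta> w) else \<zero>\<^sub>s)"
      by (simp add: star_idem zero_idem del: act.simps)
    show ?thesis
    proof (cases "rep C v \<cdot> x = rep C v")
      case True
      have "reach x ?\<beta> w" using True k(2) by simp
      then have ld: "leads (\<delta> @ ?\<beta>) w" by (rule leads_append[OF l(4) _ w])
      have "act (\<delta> @ ?\<beta>) w = act \<delta> x \<cdot> act ?\<beta> w"
      proof -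
        have "act (\<delta> @ ?\<beta>) w = act \<delta> (x \<cdot> act ?\<beta> w)"
          using act_C_mult[OF k(2), of x] True w x k by (simp add: act_append del: act.simps)
        then show ?thesis using act_mult[OF pc(3) bw, of \<delta>] by simp
      qed
      then have "act \<alpha> w \<cdot> star (act (\<delta> @ ?\<beta>) w) = act \<alpha> w \<cdot> star (act ?\<beta> w) \<cdot> star (act \<delta> x)"
        using bw by (simp add: star_mult mult_assoc del: act.simps)
      then show ?thesis
        using Some[of \<alpha> w "\<delta> @ ?\<beta>"] l(1) ld m wx True
        by (simp add: triple_def down_nonempty[OF w] del: act.simps)
    next
      case False
      then show ?thesis using None wx m by (simp add: triple_def)
    qed
  next
    case par
    then have "lgs_mult G coh_lab a b = None" by (auto simp: a_def b_def)
    then show ?thesis using None star_act_act_orthogonal[OF l(2,3) par] by simp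
  qed
qed

lemma coh_semigroup_mult:
  assumes "a \<in> carrier (coh_semigroup S C)" "b \<in> carrier (coh_semigroup S C)"
  shows "a \<cdot>\<^bsub>coh_semigroup S C\<^esub> b \<in> carrier (coh_semigroup S C)"
    and "embed (a \<cdot>\<^bsub>coh_semigroup S C\<^esub> b) = embed a \<cdot> embed b"
proof -
  have mult: "a \<cdot>\<^bsub>coh_semigroup S C\<^esub> b = lgs_mult G coh_lab a b"
    by (simp add: coh_semigroup_def lgs_semigroup_def)
  note e = embed_closed[OF assms(1)] embed_closed[OF assms(2)]
  have "lgs_mult G coh_lab a b \<in> carrier (coh_semigroup S C) \<and>
      embed (lgs_mult G coh_lab a b) = embed a \<cdot> embed b"
  proof (cases "a = None \<or> b = None")
    case True
    then show ?thesis
      using e by (cases a; cases b) (auto simp: zero_left zero_right carrier_coh_semigroup)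
  next
    case False
    then obtain \<alpha> w \<beta> \<gamma> x \<delta> where "a = Some (\<alpha>, down w, \<beta>)" "leads \<alpha> w" "leads \<beta> w"
      "b = Some (\<gamma>, down x, \<delta>)" "leads \<gamma> x" "leads \<delta> x"
      using assms unfolding carrier_coh_semigroup by auto
    then show ?thesis using product_closed_embed by blast
  qed
  then show "a \<cdot>\<^bsub>coh_semigroup S C\<^esub> b \<in> carrier (coh_semigroup S C)"
    "embed (a \<cdot>\<^bsub>coh_semigroup S C\<^esub> b) = embed a \<cdot> embed b"
    unfolding mult by blast+
qed

section \<open>Injectivity and the image of the embedding\<close>

text \<open>With \<open>P = T\<^sub>\<alpha> e\<^sub>w\<close> and \<open>Z = T\<^sub>\<gamma> e\<^sub>x\<close>, the equation gives \<open>e\<^sub>w = e\<^sub>w Z Z\<^sup>* e\<^sub>w\<close>. If \<open>\<gamma>\<close> had a first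
  letter \<open>(v, f)\<close>, the right-hand side would be below \<open>f\<close>, and so would the nonzero element \<open>e\<^sub>w\<close> of
  \<open>C\<close>. If \<open>\<gamma>\<close> is empty, \<open>Z = e\<^sub>x\<close>, and by symmetry \<open>e\<^sub>w\<close> and \<open>e\<^sub>x\<close> are below each other.\<close>

lemma same_range_prefix:
  assumes p: "leads \<alpha> w" and q: "leads (\<alpha> @ \<gamma>) x"
    and eq: "act \<alpha> w \<cdot> star (act \<alpha> w) = act (\<alpha> @ \<gamma>) x \<cdot> star (act (\<alpha> @ \<gamma>) x)"
  shows "\<gamma> = [] \<and> w = x"
proof -
  define P Q Z where "P = act \<alpha> w" and "Q = act (\<alpha> @ \<gamma>) x" and "Z = act \<gamma> x"
  note pp = leads_act[OF p, folded P_def] and qq = leads_act[OF q, folded Q_def]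
  have Zc: "Z \<in> carrier S" unfolding Z_def by (rule act_closed[OF qq(3)])
  note [simp] = pp(3,5) qq(3,5) Zc star_closed mult_closed
  have eq': "P \<cdot> star P = Q \<cdot> star Q" using eq by (simp add: P_def Q_def)
  have PQ: "star P \<cdot> Q = w \<cdot> Z" using star_act_act[OF p q] by (simp add: P_def Q_def Z_def)
  have ww: "w \<cdot> w = w" by (rule idemD(2)[OF pp(4)])
  have "w = star P \<cdot> (P \<cdot> star P) \<cdot> P" using pp(6) ww mult_assoc[of "star P" P "star P \<cdot> P"]
    by (simp add: mult_assoc)
  also have "\<dots> = (star P \<cdot> Q) \<cdot> star (star P \<cdot> Q)"
    unfolding eq' by (simp add: star_mult star_star mult_assoc)
  also have "\<dots> = w \<cdot> (Z \<cdot> star Z) \<cdot> w"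
    unfolding PQ by (simp add: star_mult star_idem[OF pp(4)] mult_assoc)
  finally have w: "w = w \<cdot> (Z \<cdot> star Z) \<cdot> w" .
  show ?thesis
  proof (cases \<gamma>)
    case Nil
    have "w = w \<cdot> x \<cdot> w" using w Nil by (simp add: Z_def star_idem[OF qq(4)] idemD(2)[OF qq(4)])
    then have "w = w \<cdot> x"
      using idem_commute[OF pp(4) qq(4)] mult_assoc[of x w w] ww by simp
    moreover have "x = x \<cdot> w \<cdot> x"
    proof -
      have QP: "star Q \<cdot> P = star (star P \<cdot> Q)" by (simp add: star_mult star_star)
      have xx: "x \<cdot> x = x" by (rule idemD(2)[OF qq(4)])
      have Zx: "Z = x" by (simp add: Z_def Nil)
      have "x = star Q \<cdot> (Q \<cdot> star Q) \<cdot> Q" using qq(6) xx mult_assoc[of "star Q" Q "star Q \<cdot> Q"]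
        by (simp add: mult_assoc)
      also have "\<dots> = star (star P \<cdot> Q) \<cdot> (star P \<cdot> Q)"
        unfolding eq'[symmetric] by (simp add: star_mult star_star mult_assoc)
      also have "\<dots> = x \<cdot> w \<cdot> x"
        unfolding PQ Zx using ww mult_assoc[of x w "w \<cdot> x"] mult_assoc[of w w x]
        by (simp add: star_mult star_idem[OF pp(4)] star_idem[OF qq(4)] mult_assoc)
      finally show ?thesis .
    qed
    then have "x = x \<cdot> w"
      using idem_commute[OF pp(4) qq(4)] mult_assoc[of w x x] idemD(2)[OF qq(4)] by simp
    ultimately show ?thesis using Nil idem_commute[OF pp(4) qq(4)] by simp
  next
    case (Cons l \<gamma>')
    obtain v f where l: "l = (v, f)" by force
    obtain k where k: "reach k ((v, f) # \<gamma>') x"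
      using q reach_suffix unfolding Cons l leads_def by blast
    then have ex: "exit (rep C v) f" by simp
    have fc [simp]: "f \<in> carrier S" by (rule exitD(11)[OF ex])
    have fZ: "f \<cdot> Z = Z" using act_first[OF k qq(3)] by (simp add: Z_def Cons l)
    have wf: "w \<cdot> f = f \<cdot> w" by (rule idem_commute[OF pp(4) exitD(6)[OF ex]])
    have "f \<cdot> (w \<cdot> (Z \<cdot> star Z) \<cdot> w) = (f \<cdot> w) \<cdot> (Z \<cdot> star Z) \<cdot> w"
      by (simp add: mult_assoc)
    also have "\<dots> = w \<cdot> ((f \<cdot> Z) \<cdot> star Z) \<cdot> w" unfolding wf[symmetric] by (simp add: mult_assoc)
    also have "\<dots> = w" unfolding fZ w[symmetric] ..
    finally have "f \<cdot> w = w" unfolding w[symmetric] .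
    then have "w = \<zero>\<^sub>s" using exit_above_no_C[OF ex pp(1)] wf by simp
    then show ?thesis using pp(2) by simp
  qed
qed

lemma same_range:
  assumes p: "leads \<alpha> w" and q: "leads \<beta> x"
    and eq: "act \<alpha> w \<cdot> star (act \<alpha> w) = act \<beta> x \<cdot> star (act \<beta> x)"
  shows "\<alpha> = \<beta> \<and> w = x"
proof -
  consider (par) "\<alpha> \<parallel> \<beta>" | \<gamma> where "\<beta> = \<alpha> @ \<gamma>" | \<gamma> where "\<alpha> = \<beta> @ \<gamma>"
    unfolding parallel_def by (auto simp: prefix_def)
  then show ?thesis
  proof cases
    case par
    define P Q where "P = act \<alpha> w" and "Q = act \<beta> x"
    note pp = leads_act[OF p, folded P_def] and qq = leads_act[OF q, folded Q_def]
    note [simp] = pp(3,5) qq(3,5) star_closed mult_closed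
    have "w = w \<cdot> w" using idemD(2)[OF pp(4)] by simp
    also have "\<dots> = star P \<cdot> (P \<cdot> star P) \<cdot> P" unfolding pp(6)[symmetric] by (simp add: mult_assoc)
    also have "\<dots> = star P \<cdot> Q \<cdot> (star Q \<cdot> P)"
      using eq by (simp add: P_def[symmetric] Q_def[symmetric] mult_assoc)
    also have "\<dots> = \<zero>\<^sub>s"
      using star_act_act_orthogonal[OF p q par, folded P_def Q_def] by (simp add: zero_left)
    finally show ?thesis using pp(2) by simp
  next
    case 2
    have "\<gamma> = [] \<and> w = x"
      by (rule same_range_prefix) (use 2 p q eq in simp_all)
    then show ?thesis using 2 by simp
  next
    case 3
    have "\<gamma> = [] \<and> x = w"
      by (rule same_range_prefix) (use 3 p q eq[symmetric] in simp_all)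
    then show ?thesis using 3 by simp
  qed
qed

text \<open>The image of a triple is a partial isomorphism between the two idempotents that belong to its
  words, factored through the representative of their common \<open>\<D>\<close>-class.\<close>

lemma partial_iso:
  assumes p: "leads \<alpha> w" and q: "leads \<beta> w"
  defines "s \<equiv> act \<alpha> w \<cdot> star (act \<beta> w)"
  shows "s \<in> carrier S" "star s = act \<beta> w \<cdot> star (act \<alpha> w)"
    "s \<cdot> star s = act \<alpha> w \<cdot> star (act \<alpha> w)" "star s \<cdot> s = act \<beta> w \<cdot> star (act \<beta> w)"
proof -
  define P Q where "P = act \<alpha> w" and "Q = act \<beta> w"
  note pp = leads_act[OF p, folded P_def] and qq = leads_act[OF q, folded Q_def]
  note [simp] = pp(5) qq(5) star_closed mult_closed
  have s: "s = P \<cdot> star Q" by (simp add: s_def P_def Q_def)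
  then have st: "star s = Q \<cdot> star P" by (simp add: star_mult star_star)
  have "P \<cdot> star Q \<cdot> (Q \<cdot> star P) = P \<cdot> (star Q \<cdot> Q) \<cdot> star P"
    by (simp add: mult_assoc)
  then have 1: "s \<cdot> star s = P \<cdot> star P" unfolding st unfolding s using pp(7) qq(6) by simp
  have "Q \<cdot> star P \<cdot> (P \<cdot> star Q) = Q \<cdot> (star P \<cdot> P) \<cdot> star Q"
    by (simp add: mult_assoc)
  then have 2: "star s \<cdot> s = Q \<cdot> star Q" unfolding st unfolding s using pp(6) qq(7) by simp
  show "s \<in> carrier S" by (simp add: s)
  show "star s = act \<beta> w \<cdot> star (act \<alpha> w)" "s \<cdot> star s = act \<alpha> w \<cdot> star (act \<alpha> w)"
    "star s \<cdot> s = act \<beta> w \<cdot> star (act \<beta> w)"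
    using st 1 2 unfolding P_def Q_def .
qed

lemma embed_nonzero:
  assumes "leads \<alpha> w" "leads \<beta> w" shows "act \<alpha> w \<cdot> star (act \<beta> w) \<noteq> \<zero>\<^sub>s"
proof
  note pp = leads_act[OF assms(1)]
  assume "act \<alpha> w \<cdot> star (act \<beta> w) = \<zero>\<^sub>s"
  then have "act \<alpha> w \<cdot> star (act \<alpha> w) = \<zero>\<^sub>s"
    using partial_iso[OF assms] zero_left star_closed[OF zero_closed] by simp
  then have "act \<alpha> w = \<zero>\<^sub>s" using mult_star_mult[OF pp(5)] zero_left[OF pp(5)] by simp
  then show False using pp(2,6) zero_right[OF star_closed[OF pp(5)]] by simp
qed

lemma embed_inj: "inj_on embed (carrier (coh_semigroup S C))"
proof (rule inj_onI)
  fix a b assume a: "a \<in> carrier (coh_semigroup S C)" and b: "b \<in> carrier (coh_semigroup S C)"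
    and eq: "embed a = embed b"
  from a show "a = b"
  proof (cases rule: coh_semigroup_cases)
    case 1
    from b show ?thesis
      by (cases rule: coh_semigroup_cases) (use 1 eq embed_nonzero in \<open>auto simp: embed_Some\<close>)
  next
    case (2 \<alpha> w \<beta>)
    note A = this
    from b show ?thesis
    proof (cases rule: coh_semigroup_cases)
      case 1
      then show ?thesis using A eq embed_nonzero by (auto simp: embed_Some)
    next
      case (2 \<gamma> x \<delta>)
      have "act \<alpha> w \<cdot> star (act \<beta> w) = act \<gamma> x \<cdot> star (act \<delta> x)"
        using eq unfolding A(1) 2(1) embed_Some[OF A(4)] embed_Some[OF 2(4)] .
      then have "act \<alpha> w \<cdot> star (act \<alpha> w) = act \<gamma> x \<cdot> star (act \<gamma> x)"
        "act \<beta> w \<cdot> star (act \<beta> w) = act \<delta> x \<cdot> star (act \<delta> x)"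
        using partial_iso(3,4)[OF A(2,3)] partial_iso(3,4)[OF 2(2,3)] by simp_all
      then show ?thesis using same_range[OF A(2) 2(2)] same_range[OF A(3) 2(3)] A(1) 2(1) by blast
    qed
  qed
qed

text \<open>The idempotents \<open>s s\<^sup>*\<close> and \<open>s\<^sup>* s\<close> are reached by words, from representatives of their
  \<open>\<D>\<close>-classes. These classes agree, hence so do the representatives, and the resulting triple has an
  image with the same domain and range as \<open>s\<close>.\<close>

lemma embed_surj:
  assumes s: "s \<in> carrier S" and c: "c \<in> C" "c \<cdot> s = s" and d: "d \<in> C" "s \<cdot> d = s"
  shows "s \<in> embed ` carrier (coh_semigroup S C)"
proof (cases "s = \<zero>\<^sub>s")
  case True
  then show ?thesis by (intro image_eqI[of _ _ None]) (simp_all add: carrier_coh_semigroup)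
next
  case False
  note [simp] = s star_closed mult_closed C_carrier[OF c(1)] C_carrier[OF d(1)]
  have nz: "s \<cdot> star s \<noteq> \<zero>\<^sub>s" "star s \<cdot> s \<noteq> \<zero>\<^sub>s"
    using False mult_star_mult[OF s] star_reassoc(1)[OF s] zero_left[OF s] zero_right[OF s] by auto
  then have cd: "c \<in> nzC" "d \<in> nzC" using c d False zero_left[OF s] zero_right[OF s] by auto
  have i: "s \<cdot> star s \<in> idempotents S" "star s \<cdot> s \<in> idempotents S"
    by (simp_all add: mult_star_idem star_mult_idem)
  have "c \<cdot> (s \<cdot> star s) = s \<cdot> star s" using mult_assoc[of c s "star s"] c(2) by simp
  then have "s \<cdot> star s \<cdot> c = s \<cdot> star s" using idem_commute[OF i(1) C_idem[OF c(1)]] by simp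
  then obtain n where "(covered_by S ^^ n) (s \<cdot> star s) c"
    using finite_intervals_relpow[OF i(1) C_idem[OF c(1)] nz(1)] by blast
  then obtain \<alpha> w where w: "w \<in> nzC" "reach c \<alpha> w" "act \<alpha> w \<cdot> star (act \<alpha> w) = s \<cdot> star s"
    using idem_reached cd(1) i(1) nz(1) by blast
  have "star s \<cdot> s \<cdot> d = star s \<cdot> s" using d(2) by (simp add: mult_assoc)
  then obtain m where "(covered_by S ^^ m) (star s \<cdot> s) d"
    using finite_intervals_relpow[OF i(2) C_idem[OF d(1)] nz(2)] by blast
  then obtain \<beta> x where x: "x \<in> nzC" "reach d \<beta> x" "act \<beta> x \<cdot> star (act \<beta> x) = star s \<cdot> s"
    using idem_reached cd(2) i(2) nz(2) by blast
  have l: "leads \<alpha> w" "leads \<beta> x" using w x cd by (auto simp: leads_def)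
  note pp = leads_act[OF l(1)] and qq = leads_act[OF l(2)]
  have "(w, s \<cdot> star s) \<in> greenD S" "(x, star s \<cdot> s) \<in> greenD S"
    "(star s \<cdot> s, s \<cdot> star s) \<in> greenD S"
    using pp qq w(3) x(3) i s greenD_idem_iff by blast+
  then have "repr w = repr x" using repr_eqI by metis
  then have "w = x" using w x repr_id by simp
  then have l: "leads \<alpha> w" "leads \<beta> w" using l by simp_all
  have "s = act \<alpha> w \<cdot> star (act \<beta> w)"
    by (rule combinatorial_eqI[OF combinatorial s partial_iso(1)[OF l]])
      (simp_all only: partial_iso(3,4)[OF l] w(3) x(3)[folded \<open>w = x\<close>])
  then have "s = embed (Some (\<alpha>, down w, \<beta>))" by (simp only: embed_Some[OF w(1)])
  moreover have "Some (\<alpha>, down w, \<beta>) \<in> carrier (coh_semigroup S C)"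
    using l by (auto simp: carrier_coh_semigroup)
  ultimately show ?thesis by blast
qed

text \<open>Together with \<open>embed_surj\<close> this shows that the image contains the whole corner between any two of its
  idempotents.\<close>

lemma embed_corner:
  assumes "a \<in> carrier (coh_semigroup S C)"
  shows "\<exists>c \<in> C. \<exists>d \<in> C. c \<cdot> embed a = embed a \<and> embed a \<cdot> d = embed a"
  using assms
proof (cases rule: coh_semigroup_cases)
  case 1
  have "\<zero>\<^sub>s \<in> C" using repr_mem[OF zero_idem] repr_zero_iff[OF zero_idem] by simp
  then show ?thesis using 1 zero_left zero_right zero_closed by auto
next
  case (2 \<alpha> w \<beta>)
  note pp = leads_act[OF 2(2)] and qq = leads_act[OF 2(3)]
  note [simp] = pp(5) qq(5) star_closed mult_closed
  obtain c where c: "c \<in> C" "c \<cdot> act \<alpha> w = act \<alpha> w"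
    using 2(2) reach_act unfolding leads_def by blast
  obtain d where d: "d \<in> C" "d \<cdot> act \<beta> w = act \<beta> w"
    using 2(3) reach_act unfolding leads_def by blast
  note [simp] = C_carrier[OF c(1)] C_carrier[OF d(1)]
  have "star (act \<beta> w) \<cdot> d = star (d \<cdot> act \<beta> w)"
    by (simp add: star_mult star_idem[OF C_idem[OF d(1)]])
  then have d': "star (act \<beta> w) \<cdot> d = star (act \<beta> w)" using d(2) by simp
  have e: "embed a = act \<alpha> w \<cdot> star (act \<beta> w)" by (simp only: 2(1) embed_Some[OF 2(4)])
  have "c \<cdot> embed a = embed a" using mult_assoc[of c "act \<alpha> w" "star (act \<beta> w)"] c(2) by (simp add: e)
  moreover have "embed a \<cdot> d = embed a" by (simp add: e mult_assoc d')
  ultimately show ?thesis using c(1) d(1) by blast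
qed

theorem morita_equivalent_coh_semigroup: "morita_equivalent S (coh_semigroup S C)"
proof (rule morita_equivalent_of_embedding[where \<phi> = embed])
  let ?T = "coh_semigroup S C"
  fix a assume a: "a \<in> carrier ?T"
  then show "star (embed a) \<in> embed ` carrier ?T"
  proof (cases rule: coh_semigroup_cases)
    case 1
    then show ?thesis using a star_idem[OF zero_idem] by (intro image_eqI[of _ _ None]) simp_all
  next
    case (2 \<alpha> w \<beta>)
    then have "star (embed a) = embed (Some (\<beta>, down w, \<alpha>))"
      using partial_iso(2) by (simp only: embed_Some)
    moreover have "Some (\<beta>, down w, \<alpha>) \<in> carrier ?T" using 2 by (auto simp: carrier_coh_semigroup)
    ultimately show ?thesis by blast
  qed
next
  let ?T = "coh_semigroup S C"
  fix a b s assume ab: "a \<in> idempotents ?T" "b \<in> idempotents ?T" and s: "s \<in> carrier S"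
    and as: "embed a \<cdot> s = s" and sb: "s \<cdot> embed b = s"
  have c: "a \<in> carrier ?T" "b \<in> carrier ?T" using ab by (simp_all add: idempotents_def)
  obtain e where e: "e \<in> C" "e \<cdot> embed a = embed a" using embed_corner[OF c(1)] by blast
  obtain d where d: "d \<in> C" "embed b \<cdot> d = embed b" using embed_corner[OF c(2)] by blast
  have "e \<cdot> s = s" using mult_assoc[OF C_carrier[OF e(1)] embed_closed[OF c(1)] s] as e(2) by simp
  moreover have "s \<cdot> d = s" using mult_assoc[OF s embed_closed[OF c(2)] C_carrier[OF d(1)]] sb d(2) by simp
  ultimately show "s \<in> embed ` carrier ?T" by (intro embed_surj[OF s e(1) _ d(1)])
next
  let ?T = "coh_semigroup S C"
  fix g assume g: "g \<in> idempotents S"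
  show "\<exists>a \<in> idempotents ?T. (g, embed a) \<in> greenD S"
  proof (cases "g = \<zero>\<^sub>s")
    case True
    have "None \<in> idempotents ?T"
      by (simp add: idempotents_def carrier_coh_semigroup coh_semigroup_def lgs_semigroup_def)
    moreover have "(g, \<zero>\<^sub>s) \<in> greenD S"
      using True equiv_class_eq_iff[OF greenD_equiv] zero_closed by auto
    ultimately show ?thesis by force
  next
    case False
    let ?w = "repr g"
    have w: "?w \<in> nzC" using False repr_mem[OF g] repr_zero_iff[OF g] by simp
    have i: "?w \<in> idempotents S" using w C_idem by simp
    let ?a = "Some ([], down ?w, [])"
    have "leads [] ?w" unfolding leads_def using w idemD(2)[OF i] by (auto intro!: bexI[of _ ?w])
    then have "?a \<in> carrier ?T" by (auto simp: carrier_coh_semigroup)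
    moreover have "?a \<cdot>\<^bsub>?T\<^esub> ?a = ?a"
      by (simp add: coh_semigroup_def lgs_semigroup_def rel_source_def triple_def down_nonempty[OF w])
    moreover have "embed ?a = ?w"
      unfolding embed_Some[OF w] by (simp add: star_idem[OF i] idemD(2)[OF i])
    moreover have "(g, ?w) \<in> greenD S" using repr_greenD[OF g] by (rule symD[OF greenD_sym])
    ultimately show ?thesis by (intro bexI[of _ ?a]) (auto simp: idempotents_def)
  qed
qed (use inverse_semigroup_axioms in \<open>simp_all add: coh_semigroup_mult embed_closed embed_inj\<close>)

end

theorem theorem5p17:
  fixes S :: "'a semigroup0" and C :: "'a set"
  assumes "inverse_semigroup0 S"
    and "combinatorial S"
    and "finite_intervals S"
    and "coherent S C"
  shows "morita_equivalent S (coh_semigroup S C)"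
proof -
  interpret inverse_semigroup0 S by (rule assms(1))
  interpret coherent_semigroup S C by unfold_locales (rule assms)+
  show ?thesis by (rule morita_equivalent_coh_semigroup)
qed

end
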